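(* Let $\alpha>-1$ and $S_0>0$. Let $V=V(y,s)\in C^2_xC^1_t(\mathbb{R}^{3+1})$, with values in $\mathbb{R}^3$, be a time periodic solution with period $S_0$ (that is, $V(y,s+S_0)=V(y,s)$ for all $(y,s)\in\mathbb{R}^3\times\mathbb{R}$) of the system $$\frac{\partial V}{\partial s}+\frac{\alpha}{\alpha+1}V+\frac{1}{\alpha+1}(y\cdot\nabla)V+(V\cdot\nabla)V=-\nabla P,\qquad \operatorname{div}V=0\qquad\text{in }\mathbb{R}^3\times\mathbb{R},$$ for some scalar function $P=P(y,s)$. Suppose that $V$ has bounded first derivatives, that $$\lim_{|y|\to\infty}\ \sup_{0<s<S_0}\bigl(|V(y,s)|+|\nabla V(y,s)|\bigr)=0,$$ and that there exists $q\in\left(0,\frac{3}{1+\alpha}\right)$ such that $$\Omega:=\operatorname{curl}V\in L^q(\mathbb{R}^3\times[0,S_0]).$$ Then $V=0$ on $\mathbb{R}^{3+1}$.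
   Context: Here $(y,s)\in\mathbb{R}^3\times\mathbb{R}=\mathbb{R}^{3+1}$; $\nabla$, $\operatorname{div}$, $\operatorname{curl}$ are taken with respect to the space variable $y$. The class $C^2_xC^1_t$ means twice continuously differentiable in the space variable $y$ and once continuously differentiable in the time variable $s$. For $0<q<1$, $f\in L^q$ means that $f$ is measurable and $\int|f|^q<\infty$. (The system is the self-similar form of the 3D incompressible Euler equations, and $s$-periodic solutions correspond to discretely self-similar Euler solutions.) *)

theory Defs
  imports "HOL-Analysis.Analysis"
begin

text \<open>Velocity fields on $\mathbb{R}^3 \times \mathbb{R}$ are curried: \<open>V y s\<close>, with \<open>y\<close> the space
  and \<open>s\<close> the time variable.\<close>

definition dt :: "(real^3 \<Rightarrow> real \<Rightarrow> real^3) \<Rightarrow> real^3 \<Rightarrow> real \<Rightarrow> real^3" where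
  "dt V y s = vector_derivative (V y) (at s)"

text \<open>The entry \<open>Dx V y s $ i $ j\<close> is $\partial V_i / \partial y_j$, so that \<open>Dx V y s *v w\<close> is
  $(w \cdot \nabla) V$; the norm on \<open>real^3^3\<close> is the Frobenius norm.\<close>
definition Dx :: "(real^3 \<Rightarrow> real \<Rightarrow> real^3) \<Rightarrow> real^3 \<Rightarrow> real \<Rightarrow> real^3^3" where
  "Dx V y s = jacobian (\<lambda>x. V x s) (at y)"

definition divx :: "(real^3 \<Rightarrow> real \<Rightarrow> real^3) \<Rightarrow> real^3 \<Rightarrow> real \<Rightarrow> real" where
  "divx V y s = trace (Dx V y s)"

definition curlx :: "(real^3 \<Rightarrow> real \<Rightarrow> real^3) \<Rightarrow> real^3 \<Rightarrow> real \<Rightarrow> real^3" where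
  "curlx V y s = vector
     [Dx V y s $ 3 $ 2 - Dx V y s $ 2 $ 3,
      Dx V y s $ 1 $ 3 - Dx V y s $ 3 $ 1,
      Dx V y s $ 2 $ 1 - Dx V y s $ 1 $ 2]"

text \<open>All derivatives involved are required to be jointly continuous in \<open>(y, s)\<close>. Continuity of
  the second space derivative is expressed through all its directional values \<open>h\<close>, which in finite
  dimension amounts to continuity of all second order partial derivatives.\<close>
definition C2x_C1t :: "(real^3 \<Rightarrow> real \<Rightarrow> real^3) \<Rightarrow> bool" where
  "C2x_C1t V \<longleftrightarrow>
     continuous_on UNIV (\<lambda>(y, s). V y s) \<and>
     (\<forall>y s. (\<lambda>x. V x s) differentiable (at y)) \<and>
     continuous_on UNIV (\<lambda>(y, s). Dx V y s) \<and>
     (\<forall>y s. (\<lambda>x. Dx V x s) differentiable (at y)) \<and>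
     (\<forall>h. continuous_on UNIV (\<lambda>(y, s). frechet_derivative (\<lambda>x. Dx V x s) (at y) h)) \<and>
     (\<forall>y s. V y differentiable (at s)) \<and>
     continuous_on UNIV (\<lambda>(y, s). dt V y s)"

text \<open>The pressure is only required to have a space gradient at every point; neither periodicity
  nor any regularity in time is imposed on it.\<close>
definition self_similar_Euler ::
  "real \<Rightarrow> (real^3 \<Rightarrow> real \<Rightarrow> real^3) \<Rightarrow> (real^3 \<Rightarrow> real \<Rightarrow> real) \<Rightarrow> bool" where
  "self_similar_Euler \<alpha> V P \<longleftrightarrow>
     (\<forall>y s. \<exists>gradP. (GDERIV (\<lambda>x. P x s) y :> gradP) \<and>
        dt V y s + (\<alpha> / (\<alpha> + 1)) *\<^sub>R V y s + (1 / (\<alpha> + 1)) *\<^sub>R (Dx V y s *v y)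
          + Dx V y s *v V y s = - gradP) \<and>
     (\<forall>y s. divx V y s = 0)"

text \<open>Intended for all \<open>q > 0\<close>, including \<open>q < 1\<close>, where this is not a normed space.\<close>
definition in_Lq ::
  "real \<Rightarrow> 'a::euclidean_space set \<Rightarrow> ('a \<Rightarrow> 'b::real_normed_vector) \<Rightarrow> bool" where
  "in_Lq q A f \<longleftrightarrow>
     f \<in> borel_measurable (lebesgue_on A) \<and>
     (\<integral>\<^sup>+ x. ennreal (norm (f x) powr q) \<partial>lebesgue_on A) < \<infinity>"

end

theory Submission
  imports Defs
begin

text \<open>Along the field \<open>drift = y / (\<alpha> + 1) + V\<close>, whose divergence is \<open>3 / (\<alpha> + 1)\<close>, the vorticity
  \<open>W = Dx V - (Dx V)\<^sup>T\<close> decays at most at the rate \<open>1 + 2 |Dx V|\<close>. Integrating \<open>|W| powr p\<close> against a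
  weight \<open>\<phi>(y) \<ge> 0\<close> over one period therefore gives
  \<open>\<integral>\<integral> |W| powr p ((3 / (\<alpha> + 1) - p (1 + 2 M)) \<phi> + drift \<cdot> \<nabla>\<phi>) \<le> 0\<close>
  whenever \<open>|Dx V| \<le> M\<close> on the support of \<open>\<phi>\<close>. Near infinity \<open>M\<close> may be taken small and the drift
  points outward, so with \<open>p = q\<close> the vorticity vanishes outside a ball. Then every small \<open>p\<close> is
  admissible, which absorbs the global gradient bound, and the vorticity vanishes everywhere.
  Hence \<open>V\<close> is curl free and divergence free, that is, harmonic, and tends to zero at infinity.\<close>

section \<open>Calculus\<close>

text \<open>The obstacle is that \<open>q\<close> may be below 1 and that only this one power of the
  vorticity is known to be integrable over the whole space. As \<open>norm W powr p\<close> need not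
  be differentiable at zeros of \<open>W\<close>, the estimate is proved for
  \<open>(W \<bullet> W + \<delta>) powr (p / 2)\<close> and passed to the limit. As space has
  infinite measure, integrability for \<open>q\<close> gives none for smaller powers, so the
  exponent cannot be lowered before the support is known to be bounded; the far field has to be
  treated with \<open>q\<close> itself, and \<open>q < 3 / (\<alpha> + 1)\<close> leaves room there
  for a small gradient bound. The drift grows linearly, so the gradient of an outer cutoff at radius
  \<open>sqrt L\<close> contributes a term that is bounded but not uniformly small; it disappears by
  dominated convergence as \<open>L\<close> grows, with the integrable power as majorant.\<close>

lemma mixed_second_derivatives_equal:
  fixes F F1 F2 F12 F21 :: "real \<Rightarrow> real \<Rightarrow> real"
  assumes F1: "\<And>t r. ((\<lambda>t. F t r) has_real_derivative F1 t r) (at t)"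
    and F2: "\<And>t r. ((\<lambda>r. F t r) has_real_derivative F2 t r) (at r)"
    and F12: "\<And>t r. ((\<lambda>r. F1 t r) has_real_derivative F12 t r) (at r)"
    and F21: "\<And>t r. ((\<lambda>t. F2 t r) has_real_derivative F21 t r) (at t)"
    and c12: "isCont (\<lambda>(t, r). F12 t r) (0, 0)"
    and c21: "isCont (\<lambda>(t, r). F21 t r) (0, 0)"
  shows "F12 0 0 = F21 0 0"
proof (rule ccontr)
  assume ne: "F12 0 0 \<noteq> F21 0 0"
  \<comment> \<open>Half the gap: two numbers within \<open>e\<close> of the two values cannot
    coincide.\<close>
  define e where "e = \<bar>F12 0 0 - F21 0 0\<bar> / 2"
  have "e > 0" using ne by (simp add: e_def)
  obtain d1 where d1: "d1 > 0" "\<And>p. dist p (0, 0) < d1 \<Longrightarrow> \<bar>(case p of (t, r) \<Rightarrow> F12 t r) - F12 0 0\<bar> < e"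
    using c12 \<open>e > 0\<close> unfolding continuous_at_eps_delta by (auto simp: dist_real_def)
  obtain d2 where d2: "d2 > 0" "\<And>p. dist p (0, 0) < d2 \<Longrightarrow> \<bar>(case p of (t, r) \<Rightarrow> F21 t r) - F21 0 0\<bar> < e"
    using c21 \<open>e > 0\<close> unfolding continuous_at_eps_delta by (auto simp: dist_real_def)
  define h where "h = min d1 d2 / 2"
  have "h > 0" using d1 d2 by (simp add: h_def)
  \<comment> \<open>The second difference of \<open>F\<close> over the square of side
    \<open>h\<close> is grouped in two ways. Two mean value theorems per grouping turn it into
    \<open>h * h\<close> times either mixed derivative at some point of the square.\<close>
  obtain t where t: "0 < t" "t < h" "(F h h - F h 0) - (F 0 h - F 0 0) = (h - 0) * (F1 t h - F1 t 0)"
    using MVT2[OF \<open>h > 0\<close> DERIV_diff[OF F1[where r=h] F1[where r=0]]] by blast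
  obtain r where r: "0 < r" "r < h" "F1 t h - F1 t 0 = (h - 0) * F12 t r"
    using MVT2[OF \<open>h > 0\<close>, of "F1 t" "F12 t"] F12 by auto
  obtain r' where r': "0 < r'" "r' < h" "(F h h - F 0 h) - (F h 0 - F 0 0) = (h - 0) * (F2 h r' - F2 0 r')"
    using MVT2[OF \<open>h > 0\<close> DERIV_diff[OF F2[where t=h] F2[where t=0]]] by blast
  obtain t' where t': "0 < t'" "t' < h" "F2 h r' - F2 0 r' = (h - 0) * F21 t' r'"
    using MVT2[OF \<open>h > 0\<close>, of "\<lambda>t. F2 t r'" "\<lambda>t. F21 t r'"] F21 by auto
  have "h * (h * F12 t r) = h * (h * F21 t' r')"
    using t(3) r'(3) unfolding r(3) t'(3) diff_zero by linarith
  then have eq: "F12 t r = F21 t' r'" using \<open>h > 0\<close> by simp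
  have near: "dist (t, r) (0::real, 0::real) < min d1 d2" if "0 < t" "t < h" "0 < r" "r < h" for t r
  proof -
    have "dist (t, r) (0::real, 0::real) \<le> \<bar>t\<bar> + \<bar>r\<bar>"
      by (simp add: norm_prod_def dist_norm sqrt_sum_squares_le_sum_abs)
    also have "\<dots> < min d1 d2" using that by (simp add: h_def)
    finally show ?thesis .
  qed
  have "\<bar>F12 t r - F12 0 0\<bar> < e" "\<bar>F21 t' r' - F21 0 0\<bar> < e"
    using d1(2)[of "(t, r)"] d2(2)[of "(t', r')"] near t r t' r' by auto
  then show False using eq unfolding e_def by (smt (verit) field_sum_of_halves)
qed

section \<open>Maximum principle for harmonic functions\<close>

text \<open>If \<open>d\<close> were positive, \<open>g'\<close>, which vanishes at the maximum,
  would be positive just to the right of 0 and \<open>g\<close> would increase there. Only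
  differentiability of \<open>g'\<close> at 0 is needed, so no continuity of second derivatives
  enters.\<close>

lemma second_derivative_nonpos_at_max:
  fixes g g' :: "real \<Rightarrow> real"
  assumes g: "\<And>t. (g has_real_derivative g' t) (at t)"
    and g': "(g' has_real_derivative d) (at 0)"
    and max: "0 < e" "\<And>t. \<bar>t\<bar> < e \<Longrightarrow> g t \<le> g 0"
  shows "d \<le> 0"
proof (rule ccontr)
  assume "\<not> d \<le> 0"
  then have "d > 0" by simp
  have "g' 0 = 0"
    using DERIV_local_max[OF g[of 0] max(1)] max(2) by auto
  obtain c where c: "c > 0" "\<forall>h>0. h < c \<longrightarrow> g' 0 < g' (0 + h)"
    using DERIV_pos_inc_right[OF g' \<open>d > 0\<close>] by blast
  define t where "t = min c e / 2"
  have t: "0 < t" "t < c" "t < e" using c max(1) by (auto simp: t_def)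
  obtain z where "0 < z" "z < t" "g t - g 0 = (t - 0) * g' z"
    using MVT2[OF t(1), of g g'] g by auto
  moreover have "g' z > 0" using c(2) calculation t \<open>g' 0 = 0\<close> by force
  ultimately have "g t > g 0" using t(1) by (simp add: algebra_simps mult_pos_pos)
  then show False using max(2)[of t] t by simp
qed

text \<open>Adding a small multiple of \<open>y \<bullet> y\<close> makes the Laplacian strictly
  positive, which excludes an interior maximum; if \<open>u x\<close> were positive, decay of
  \<open>u\<close> would force the maximum over a large ball into its interior.\<close>

lemma harmonic_vanishing_at_infinity_nonpos:
  fixes u :: "'a::euclidean_space \<Rightarrow> real"
  assumes cont: "continuous_on UNIV u"
    and u1: "\<And>i y t. i \<in> Basis \<Longrightarrow> ((\<lambda>t. u (y + t *\<^sub>R i)) has_real_derivative u1 i (y + t *\<^sub>R i)) (at t)"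
    and u2: "\<And>i y. i \<in> Basis \<Longrightarrow> ((\<lambda>t. u1 i (y + t *\<^sub>R i)) has_real_derivative u2 i y) (at 0)"
    and harm: "\<And>y. (\<Sum>i\<in>Basis. u2 i y) = 0"
    and lim: "(u \<longlongrightarrow> 0) at_infinity"
  shows "u x \<le> 0"
proof (rule ccontr)
  assume "\<not> u x \<le> 0"
  then have c: "u x > 0" by simp
  obtain B where B: "\<And>y. norm y \<ge> B \<Longrightarrow> \<bar>u y\<bar> < u x / 2"
    using tendstoD[OF lim, of "u x / 2"] c by (auto simp: eventually_at_infinity dist_real_def)
  define r where "r = max B (norm x) + 1"
  have r: "r > 0" "norm x < r" "B \<le> r"
    using norm_ge_zero[of x] unfolding r_def by linarith+
  \<comment> \<open>With this size the perturbation adds \<open>u x / 4\<close> on the sphere of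
    radius \<open>r\<close>, where \<open>u\<close> is below \<open>u x / 2\<close>; so
    \<open>v\<close> stays below \<open>u x\<close> there, while its maximum is at least
    \<open>u x\<close>.\<close>
  define \<epsilon> where "\<epsilon> = u x / (4 * r\<^sup>2)"
  have e: "\<epsilon> > 0" "\<epsilon> * r\<^sup>2 < u x / 2" using c r by (auto simp: \<epsilon>_def field_simps)
  define v where "v y = u y + \<epsilon> * (y \<bullet> y)" for y
  have "continuous_on (cball 0 r) v" unfolding v_def
    by (intro continuous_intros continuous_on_subset[OF cont]) auto
  then obtain z where z: "z \<in> cball 0 r" "\<And>y. y \<in> cball 0 r \<Longrightarrow> v y \<le> v z"
    using continuous_attains_sup[of "cball (0::'a) r" v] r by auto
  have vz: "v z \<ge> u x" using z(2)[of x] r e unfolding v_def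
    by (auto intro: order_trans[rotated])
  have "norm z < r"
  proof (rule ccontr)
    assume "\<not> norm z < r"
    then have nz: "norm z = r" using z(1) by simp
    then have "v z \<le> u x / 2 + \<epsilon> * r\<^sup>2"
      using B[of z] r unfolding v_def by (simp add: power2_norm_eq_inner[symmetric])
    then show False using vz e by simp
  qed
  have "u2 i z + 2 * \<epsilon> \<le> 0" if i: "i \<in> Basis" for i
  proof (rule second_derivative_nonpos_at_max[where g="\<lambda>t. v (z + t *\<^sub>R i)"
        and g'="\<lambda>t. u1 i (z + t *\<^sub>R i) + \<epsilon> * (2 * ((z + t *\<^sub>R i) \<bullet> i))" and e="r - norm z"])
    fix t
    show "((\<lambda>t. v (z + t *\<^sub>R i)) has_real_derivative u1 i (z + t *\<^sub>R i) + \<epsilon> * (2 * ((z + t *\<^sub>R i) \<bullet> i))) (at t)"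
      unfolding v_def inner_add_left inner_add_right inner_scaleR_left inner_scaleR_right
      using i by (auto intro!: derivative_eq_intros u1 simp: inner_commute algebra_simps)
    show "v (z + t *\<^sub>R i) \<le> v (z + 0 *\<^sub>R i)" if "\<bar>t\<bar> < r - norm z"
      using z(2)[of "z + t *\<^sub>R i"] norm_triangle_ineq[of z "t *\<^sub>R i"] that i by simp
  next
    show "((\<lambda>t. u1 i (z + t *\<^sub>R i) + \<epsilon> * (2 * ((z + t *\<^sub>R i) \<bullet> i))) has_real_derivative u2 i z + 2 * \<epsilon>) (at 0)"
      unfolding inner_add_left inner_scaleR_left
      using i by (auto intro!: derivative_eq_intros u2)
  qed (use \<open>norm z < r\<close> in auto)
  then have "(\<Sum>i\<in>Basis. u2 i z + 2 * \<epsilon>) \<le> (\<Sum>i\<in>(Basis::'a set). 0)"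
    by (intro sum_mono) auto
  then have "real DIM('a) * (2 * \<epsilon>) \<le> 0"
    using harm[of z] by (simp add: sum.distrib)
  moreover have "real DIM('a) * (2 * \<epsilon>) > 0" using e by simp
  ultimately show False by linarith
qed

section \<open>Integration by parts and cutoffs\<close>

text \<open>The integral of a compactly supported function does not change under translation by
  \<open>t *\<^sub>R h\<close>; differentiating this constant under the integral sign at
  \<open>t = 0\<close> gives the claim without boundary terms.\<close>

lemma has_integral_directional_derivative_0:
  fixes g :: "'a::euclidean_space \<Rightarrow> real"
  assumes der: "\<And>y. (g has_derivative g' y) (at y)"
    and cont: "continuous_on UNIV (\<lambda>y. g' y h)"
    and supp: "\<And>y. y \<notin> cbox l u \<Longrightarrow> g y = 0"
  shows "((\<lambda>y. g' y h) has_integral 0) (cbox l u)"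
proof -
  have contg: "continuous_on A g" for A
    using der by (intro continuous_at_imp_continuous_on ballI has_derivative_continuous)
  \<comment> \<open>One box that contains every translate of the support with
    \<open>\<bar>t\<bar> \<le> 1\<close>, so that the domain of integration does not depend on
    \<open>t\<close>.\<close>
  have "bounded ((\<lambda>(x, t). x - t *\<^sub>R h) ` (cbox l u \<times> {-1..1}))"
    by (intro compact_imp_bounded compact_continuous_image)
       (auto intro!: continuous_intros compact_Times simp: case_prod_unfold)
  then obtain c where c: "(\<lambda>(x, t). x - t *\<^sub>R h) ` (cbox l u \<times> {-1..1}) \<subseteq> cbox (- c) c"
    using bounded_subset_cbox_symmetric by blast
  then have cc: "x - t *\<^sub>R h \<in> cbox (- c) c" if "x \<in> cbox l u" "\<bar>t\<bar> \<le> 1" for x t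
    using that by force
  have sub: "cbox l u \<subseteq> cbox (- c) c" using cc[of _ 0] by auto
  define J where "J = integral (cbox l u) g"
  have J: "(g has_integral J) (cbox l u)"
    unfolding J_def by (intro integrable_integral integrable_continuous contg)
  have shift: "((\<lambda>x. g (x + t *\<^sub>R h)) has_integral J) (cbox (- c) c)" if t: "\<bar>t\<bar> \<le> 1" for t
  proof -
    have "((\<lambda>x. g (x + t *\<^sub>R h)) has_integral J) (cbox (l - t *\<^sub>R h) (u - t *\<^sub>R h))"
      using has_integral_affinity[OF J, of 1 "t *\<^sub>R h"] cbox_translation[of "- (t *\<^sub>R h)" l u]
      by simp
    moreover have "cbox (l - t *\<^sub>R h) (u - t *\<^sub>R h) \<subseteq> cbox (- c) c"
    proof
      fix x assume "x \<in> cbox (l - t *\<^sub>R h) (u - t *\<^sub>R h)"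
      then have "x + t *\<^sub>R h \<in> cbox l u"
        by (auto simp: mem_box inner_add_left inner_diff_left algebra_simps)
      from cc[OF this t] show "x \<in> cbox (- c) c" by simp
    qed
    moreover have "g (x + t *\<^sub>R h) = 0" if "x \<notin> cbox (l - t *\<^sub>R h) (u - t *\<^sub>R h)" for x
    proof (rule supp)
      show "x + t *\<^sub>R h \<notin> cbox l u"
        using that by (auto simp: mem_box inner_add_left inner_diff_left algebra_simps)
    qed
    ultimately show ?thesis
      by (intro has_integral_on_superset[where S="cbox (l - t *\<^sub>R h) (u - t *\<^sub>R h)" and T="cbox (- c) c"])
  qed
  let ?U = "{-1<..<1::real}"
  have line: "((\<lambda>t. g (x + t *\<^sub>R h)) has_real_derivative g' (x + t *\<^sub>R h) h) (at t within ?U)" for x t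
  proof -
    have "((\<lambda>t. g (x + t *\<^sub>R h)) has_derivative (\<lambda>s. g' (x + t *\<^sub>R h) (0 + s *\<^sub>R h))) (at t within ?U)"
      by (rule has_derivative_compose[OF _ der]) (auto intro!: derivative_eq_intros)
    then show ?thesis
      by (simp add: has_field_derivative_def linear_cmul[OF has_derivative_linear[OF der]] mult_commute_abs)
  qed
  have "((\<lambda>t. integral (cbox (- c) c) (\<lambda>x. g (x + t *\<^sub>R h))) has_field_derivative
      integral (cbox (- c) c) (\<lambda>x. g' (x + 0 *\<^sub>R h) h)) (at 0 within ?U)"
    by (rule leibniz_rule_field_derivative[where fx="\<lambda>t x. g' (x + t *\<^sub>R h) h"])
       (use line has_integral_integrable[OF shift] in \<open>auto simp: case_prod_unfold less_imp_le
          intro!: continuous_on_compose2[OF cont] continuous_intros\<close>)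
  then have "((\<lambda>t. J) has_field_derivative integral (cbox (- c) c) (\<lambda>x. g' (x + 0 *\<^sub>R h) h)) (at 0 within ?U)"
    by (rule has_field_derivative_transform_within[where d=1])
       (auto simp: dist_real_def intro!: integral_unique shift)
  then have "((\<lambda>t. J) has_field_derivative integral (cbox (- c) c) (\<lambda>x. g' x h)) (at 0)"
    by (simp add: at_within_open[of 0 ?U])
  then have "integral (cbox (- c) c) (\<lambda>x. g' x h) = 0"
    using DERIV_const DERIV_unique by blast
  then have *: "((\<lambda>x. g' x h) has_integral 0) (cbox (- c) c)"
    using integrable_integral[OF integrable_continuous[OF continuous_on_subset[OF cont subset_UNIV]]]
    by metis
  \<comment> \<open>\<open>g\<close> vanishes on the open complement of the box, hence so does its
    derivative; this leads back from the larger box to the original one.\<close>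
  have zero: "g' y h = 0" if "y \<notin> cbox l u" for y
  proof -
    have "((\<lambda>x. 0) has_derivative g' y) (at y)"
    proof (rule has_derivative_transform_within_open[OF der])
      show "open (- cbox l u)" by (simp add: open_Compl closed_cbox)
    qed (use that supp in auto)
    then have "g' y = (\<lambda>h. 0)" using has_derivative_const has_derivative_unique by blast
    then show ?thesis by simp
  qed
  show ?thesis
    using has_integral_restrict[OF sub, of "\<lambda>x. g' x h" 0] has_integral_eq[OF _ *, of "\<lambda>x. if x \<in> cbox l u then g' x h else 0"] zero
    by simp
qed

text \<open>An explicit function with continuous derivative that vanishes on a half line: the
  weights need no more than a continuous gradient. At 0 the difference quotient is
  \<open>max 0 t\<close> itself.\<close>

lemma max_0_square_has_derivative: "((\<lambda>t::real. (max 0 t)\<^sup>2) has_real_derivative 2 * max 0 t) (at t)"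
proof -
  consider "t < 0" | "t = 0" | "t > 0" by linarith
  then show ?thesis
  proof cases
    case 1
    have "((\<lambda>t::real. (max 0 t)\<^sup>2) has_real_derivative 0) (at t)"
      by (rule has_field_derivative_transform_within_open[OF DERIV_const[of 0], of "{..<0}"]) (use 1 in auto)
    then show ?thesis using 1 by simp
  next
    case 2
    have "isCont (\<lambda>t::real. max 0 t) 0" by (intro continuous_intros)
    then show ?thesis unfolding CARAT_DERIV 2
      by (intro exI[of _ "\<lambda>t. max 0 t"]) (auto simp: max_def power2_eq_square)
  next
    case 3
    have "((\<lambda>t::real. (max 0 t)\<^sup>2) has_real_derivative 2 * t) (at t)"
      by (rule has_field_derivative_transform_within_open[where f="\<lambda>t. t\<^sup>2" and S="{0<..}"])
         (use 3 in \<open>auto intro!: derivative_eq_intros\<close>)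
    then show ?thesis using 3 by simp
  qed
qed

lemma zero_on_cbox_if_integral_nonpos:
  fixes f :: "'a::euclidean_space \<Rightarrow> real"
  assumes "continuous_on (cbox a b) f" "\<And>x. x \<in> cbox a b \<Longrightarrow> 0 \<le> f x"
    and "integral (cbox a b) f \<le> 0" "box a b \<noteq> {}" "x \<in> cbox a b"
  shows "f x = 0"
proof -
  have "integral (cbox a b) f = 0"
    using assms(2,3) integral_nonneg[OF integrable_continuous[OF assms(1)]] by force
  then have "(f has_integral 0) (cbox a b)"
    using integrable_integral[OF integrable_continuous[OF assms(1)]] by simp
  then show ?thesis
    using has_integral_0_cbox_imp_0[OF assms(1) _ _ assms(4,5)] assms(2) box_subset_cbox by blast
qed

section \<open>Weighted inequality for periodic transport\<close>

lemma continuous_on_curried: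
  assumes "continuous_on UNIV (\<lambda>(y, s). F y s)" "continuous_on A g" "continuous_on A h"
  shows "continuous_on A (\<lambda>x. F (g x) (h x))"
  using continuous_on_compose2[OF assms(1) continuous_on_Pair[OF assms(2,3)]] by simp

text \<open>Over a full period the time derivative of the integral of \<open>\<phi> * f\<close>
  contributes nothing, and in space the divergence of \<open>\<phi> * f * b\<close> integrates to
  zero. What remains after integrating the differential inequality is the volume expansion
  \<open>\<kappa>\<close>, the decay rate \<open>c\<close> and the flux through the gradient of
  \<open>\<phi>\<close>.\<close>

lemma periodic_transport_inequality:
  fixes f fs :: "'a::euclidean_space \<Rightarrow> real \<Rightarrow> real" and gf b :: "'a \<Rightarrow> real \<Rightarrow> 'a"
    and b' :: "'a \<Rightarrow> real \<Rightarrow> 'a \<Rightarrow> 'a" and T :: real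
  assumes T: "0 \<le> T"
    and fs: "\<And>y s. (f y has_real_derivative fs y s) (at s)"
    and gf: "\<And>y s. GDERIV (\<lambda>y. f y s) y :> gf y s"
    and b: "\<And>y s. ((\<lambda>y. b y s) has_derivative b' y s) (at y)"
    and g\<phi>: "\<And>y. GDERIV \<phi> y :> g\<phi> y"
    and cf: "continuous_on UNIV (\<lambda>(y, s). f y s)"
    and cfs: "continuous_on UNIV (\<lambda>(y, s). fs y s)"
    and cgf: "continuous_on UNIV (\<lambda>(y, s). gf y s)"
    and cb: "continuous_on UNIV (\<lambda>(y, s). b y s)"
    and cb': "\<And>h. continuous_on UNIV (\<lambda>(y, s). b' y s h)"
    and cg\<phi>: "continuous_on UNIV g\<phi>"
    and div: "\<And>y s. (\<Sum>i\<in>Basis. b' y s i \<bullet> i) = \<kappa>"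
    and supp: "\<And>y. y \<notin> cbox l u \<Longrightarrow> \<phi> y = 0"
    and per: "\<And>y. f y T = f y 0"
    and ineq: "\<And>y s. s \<in> {0..T} \<Longrightarrow> - c * f y s * \<phi> y \<le> \<phi> y * (fs y s + gf y s \<bullet> b y s)"
  shows "integral {0..T} (\<lambda>s. integral (cbox l u)
           (\<lambda>y. f y s * ((\<kappa> - c) * \<phi> y + g\<phi> y \<bullet> b y s))) \<le> 0"
proof -
  have c\<phi>: "continuous_on UNIV \<phi>"
    using g\<phi> unfolding gderiv_def
    by (intro continuous_at_imp_continuous_on ballI has_derivative_continuous) auto
  note [continuous_intros] = continuous_on_curried[OF cf] continuous_on_curried[OF cfs]
    continuous_on_curried[OF cgf] continuous_on_curried[OF cb] continuous_on_curried[OF cb']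
    continuous_on_compose2[OF c\<phi> _ subset_UNIV] continuous_on_compose2[OF cg\<phi> _ subset_UNIV]
  define I where "I s = integral (cbox l u) (\<lambda>y. \<phi> y * f y s)" for s
  define I' where "I' s = integral (cbox l u) (\<lambda>y. \<phi> y * fs y s)" for s
  define J where "J s = integral (cbox l u) (\<lambda>y. f y s * ((\<kappa> - c) * \<phi> y + g\<phi> y \<bullet> b y s))" for s
  have I: "(I has_real_derivative I' s) (at s)" for s
    unfolding I_def I'_def
    by (rule leibniz_rule_field_derivative[where U=UNIV])
       (auto simp: case_prod_unfold intro!: derivative_eq_intros fs integrable_continuous continuous_intros)
  have "(I' has_integral (I T - I 0)) {0..T}"
    using I by (intro fundamental_theorem_of_calculus[OF T])
      (auto intro: has_vector_derivative_at_within simp: has_real_derivative_iff_has_vector_derivative)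
  moreover have "I T = I 0" by (simp add: I_def per)
  ultimately have I'0: "(I' has_integral 0) {0..T}" by simp
  have "J s \<le> I' s" if s: "s \<in> {0..T}" for s
  proof -
    \<comment> \<open>The divergence of \<open>\<phi> * f * b\<close>, one coordinate at a
      time.\<close>
    have "((\<lambda>y. (\<phi> y * f y s) * (b' y s i \<bullet> i)
            + (\<phi> y * (i \<bullet> gf y s) + (i \<bullet> g\<phi> y) * f y s) * (b y s \<bullet> i)) has_integral 0) (cbox l u)"
      if "i \<in> Basis" for i
    proof (rule has_integral_directional_derivative_0[where h=i and g="\<lambda>y. (\<phi> y * f y s) * (b y s \<bullet> i)"
          and g'="\<lambda>y h. (\<phi> y * f y s) * (b' y s h \<bullet> i)
            + (\<phi> y * (h \<bullet> gf y s) + (h \<bullet> g\<phi> y) * f y s) * (b y s \<bullet> i)"])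
      show "((\<lambda>y. (\<phi> y * f y s) * (b y s \<bullet> i)) has_derivative
         (\<lambda>h. (\<phi> y * f y s) * (b' y s h \<bullet> i)
            + (\<phi> y * (h \<bullet> gf y s) + (h \<bullet> g\<phi> y) * f y s) * (b y s \<bullet> i))) (at y)" for y
        using gf g\<phi> unfolding gderiv_def
        by (intro has_derivative_mult has_derivative_inner_left b) auto
    qed (auto intro!: continuous_intros simp: supp)
    from has_integral_sum[OF finite_Basis this]
    have "((\<lambda>y. \<Sum>i\<in>Basis. (\<phi> y * f y s) * (b' y s i \<bullet> i)
            + (\<phi> y * (i \<bullet> gf y s) + (i \<bullet> g\<phi> y) * f y s) * (b y s \<bullet> i)) has_integral 0) (cbox l u)"
      by simp
    also have "(\<lambda>y. \<Sum>i\<in>Basis. (\<phi> y * f y s) * (b' y s i \<bullet> i)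
            + (\<phi> y * (i \<bullet> gf y s) + (i \<bullet> g\<phi> y) * f y s) * (b y s \<bullet> i))
       = (\<lambda>y. \<phi> y * f y s * \<kappa> + \<phi> y * (gf y s \<bullet> b y s) + f y s * (g\<phi> y \<bullet> b y s))"
    proof
      fix y
      have 1: "gf y s \<bullet> b y s = (\<Sum>i\<in>Basis. (gf y s \<bullet> i) * (b y s \<bullet> i))"
        and 2: "g\<phi> y \<bullet> b y s = (\<Sum>i\<in>Basis. (g\<phi> y \<bullet> i) * (b y s \<bullet> i))"
        by (rule euclidean_inner)+
      show "(\<Sum>i\<in>Basis. (\<phi> y * f y s) * (b' y s i \<bullet> i)
            + (\<phi> y * (i \<bullet> gf y s) + (i \<bullet> g\<phi> y) * f y s) * (b y s \<bullet> i))
          = \<phi> y * f y s * \<kappa> + \<phi> y * (gf y s \<bullet> b y s) + f y s * (g\<phi> y \<bullet> b y s)"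
        unfolding 1 2 div[symmetric, of y s] sum_distrib_left sum.distrib[symmetric]
        by (intro sum.cong) (auto simp: inner_commute algebra_simps)
    qed
    finally have D: "((\<lambda>y. \<phi> y * f y s * \<kappa> + \<phi> y * (gf y s \<bullet> b y s) + f y s * (g\<phi> y \<bullet> b y s))
        has_integral 0) (cbox l u)" .
    have "((\<lambda>y. \<phi> y * fs y s + (\<phi> y * f y s * \<kappa> + \<phi> y * (gf y s \<bullet> b y s) + f y s * (g\<phi> y \<bullet> b y s)))
        has_integral (I' s + 0)) (cbox l u)"
      unfolding I'_def
      by (intro has_integral_add D integrable_integral integrable_continuous continuous_intros)
    then have H: "((\<lambda>y. \<phi> y * fs y s + (\<phi> y * f y s * \<kappa> + \<phi> y * (gf y s \<bullet> b y s) + f y s * (g\<phi> y \<bullet> b y s)))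
        has_integral I' s) (cbox l u)" by simp
    have "((\<lambda>y. f y s * ((\<kappa> - c) * \<phi> y + g\<phi> y \<bullet> b y s)) has_integral J s) (cbox l u)"
      unfolding J_def by (intro integrable_integral integrable_continuous continuous_intros)
    then show ?thesis
    proof (rule has_integral_le[OF _ H])
      show "f y s * ((\<kappa> - c) * \<phi> y + g\<phi> y \<bullet> b y s)
          \<le> \<phi> y * fs y s + (\<phi> y * f y s * \<kappa> + \<phi> y * (gf y s \<bullet> b y s) + f y s * (g\<phi> y \<bullet> b y s))" for y
        using ineq[OF s, of y] by (simp add: algebra_simps)
    qed
  qed
  moreover have "J integrable_on {0..T}"
  proof -
    have "continuous_on {0..T} J" unfolding J_def
      by (rule integral_continuous_on_param) (auto simp: case_prod_unfold intro!: continuous_intros)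
    then show ?thesis by (rule integrable_continuous_real)
  qed
  ultimately have "integral {0..T} J \<le> 0"
    using I'0 by (intro has_integral_le[OF integrable_integral I'0]) auto
  then show ?thesis unfolding J_def .
qed

lemma norm_powr_eq_inner_powr: "norm x powr p = (x \<bullet> x) powr (p / 2)"
  by (simp add: power2_norm_eq_inner[symmetric] powr_powr flip: powr_numeral)

text \<open>The scalar inequality is applied to
  \<open>(W \<bullet> W + \<delta>) powr (p / 2)\<close>, which is differentiable even where
  \<open>W\<close> vanishes, and \<open>\<delta>\<close> is sent to 0 in the resulting integral,
  which contains no derivative of the power.\<close>

lemma periodic_transport_powr:
  fixes W Wt :: "'a::euclidean_space \<Rightarrow> real \<Rightarrow> 'w::euclidean_space" and b :: "'a \<Rightarrow> real \<Rightarrow> 'a"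
    and W' :: "'a \<Rightarrow> real \<Rightarrow> 'a \<Rightarrow> 'w" and b' :: "'a \<Rightarrow> real \<Rightarrow> 'a \<Rightarrow> 'a" and T p m :: real
  assumes T: "0 \<le> T" and p: "0 < p" and m: "0 \<le> m"
    and Wt: "\<And>y s. (W y has_vector_derivative Wt y s) (at s)"
    and W': "\<And>y s. ((\<lambda>y. W y s) has_derivative W' y s) (at y)"
    and b: "\<And>y s. ((\<lambda>y. b y s) has_derivative b' y s) (at y)"
    and g\<phi>: "\<And>y. GDERIV \<phi> y :> g\<phi> y"
    and cW: "continuous_on UNIV (\<lambda>(y, s). W y s)"
    and cWt: "continuous_on UNIV (\<lambda>(y, s). Wt y s)"
    and cW': "\<And>h. continuous_on UNIV (\<lambda>(y, s). W' y s h)"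
    and cb: "continuous_on UNIV (\<lambda>(y, s). b y s)"
    and cb': "\<And>h. continuous_on UNIV (\<lambda>(y, s). b' y s h)"
    and cg\<phi>: "continuous_on UNIV g\<phi>"
    and div: "\<And>y s. (\<Sum>i\<in>Basis. b' y s i \<bullet> i) = \<kappa>"
    and supp: "\<And>y. y \<notin> cbox l u \<Longrightarrow> \<phi> y = 0"
    and pos: "\<And>y. 0 \<le> \<phi> y"
    and per: "\<And>y. W y T = W y 0"
    and ineq: "\<And>y s. s \<in> {0..T} \<Longrightarrow> \<phi> y \<noteq> 0 \<Longrightarrow>
        - m * (W y s \<bullet> W y s) \<le> W y s \<bullet> (Wt y s + W' y s (b y s))"
  shows "integral {0..T} (\<lambda>s. integral (cbox l u)
           (\<lambda>y. norm (W y s) powr p * ((\<kappa> - p * m) * \<phi> y + g\<phi> y \<bullet> b y s))) \<le> 0"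
proof -
  have c\<phi>: "continuous_on UNIV \<phi>"
    using g\<phi> unfolding gderiv_def
    by (intro continuous_at_imp_continuous_on ballI has_derivative_continuous) auto
  note [continuous_intros] = continuous_on_curried[OF cW] continuous_on_curried[OF cWt]
    continuous_on_curried[OF cb] continuous_on_curried[OF cb'] continuous_on_curried[OF cW']
    continuous_on_compose2[OF c\<phi> _ subset_UNIV] continuous_on_compose2[OF cg\<phi> _ subset_UNIV]
  define K where "K \<delta> = integral {0..T} (\<lambda>s. integral (cbox l u)
           (\<lambda>y. (W y s \<bullet> W y s + \<delta>) powr (p/2) * ((\<kappa> - p * m) * \<phi> y + g\<phi> y \<bullet> b y s)))" for \<delta>
  have K: "K \<delta> \<le> 0" if "\<delta> > 0" for \<delta>
    unfolding K_def
  proof (rule periodic_transport_inequality[OF T _ _ b g\<phi> _ _ _ cb cb' cg\<phi> div supp])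
    \<comment> \<open>The common chain rule factor of all derivatives of the regularised power: the
      2 from \<open>W \<bullet> W\<close> cancels the half in \<open>p / 2\<close>.\<close>
    define \<beta> where "\<beta> y s = p * (W y s \<bullet> W y s + \<delta>) powr (p/2 - 1)" for y s
    have pos': "W y s \<bullet> W y s + \<delta> > 0" for y s using that by (simp add: add_nonneg_pos)
    show "((\<lambda>s. (W y s \<bullet> W y s + \<delta>) powr (p/2)) has_real_derivative \<beta> y s * (W y s \<bullet> Wt y s)) (at s)" for y s
    proof -
      have "((\<lambda>s. W y s \<bullet> W y s + \<delta>) has_real_derivative 2 * (W y s \<bullet> Wt y s)) (at s)"
        using Wt unfolding has_vector_derivative_def has_field_derivative_def
        by (auto intro!: derivative_eq_intros simp: inner_commute)
      from DERIV_fun_powr[OF this pos', of "p/2"] show ?thesis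
        by (simp add: \<beta>_def mult_ac)
    qed
    \<comment> \<open>Continuity of \<open>W'\<close> is available only for fixed directions, so the
      gradient is assembled from basis directions.\<close>
    have W'sum: "W' y s h = (\<Sum>i\<in>Basis. (h \<bullet> i) *\<^sub>R W' y s i)" for y s h
    proof -
      have "W' y s h = W' y s (\<Sum>i\<in>Basis. (h \<bullet> i) *\<^sub>R i)" by (simp add: euclidean_representation)
      then show ?thesis
        by (simp add: linear_sum[OF has_derivative_linear[OF W']] linear_cmul[OF has_derivative_linear[OF W']])
    qed
    have gf: "(\<Sum>i\<in>Basis. (\<beta> y s * (W y s \<bullet> W' y s i)) *\<^sub>R i) \<bullet> h = \<beta> y s * (W y s \<bullet> W' y s h)" for y s h
      by (subst W'sum) (simp add: inner_sum_left inner_sum_right sum_distrib_left inner_commute mult_ac)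
    show "GDERIV (\<lambda>y. (W y s \<bullet> W y s + \<delta>) powr (p/2)) y :>
        (\<Sum>i\<in>Basis. (\<beta> y s * (W y s \<bullet> W' y s i)) *\<^sub>R i)" for y s
    proof -
      have 1: "((\<lambda>x. x powr (p/2)) has_derivative (*) (p/2 * (W y s \<bullet> W y s + \<delta>) powr (p/2-1)))
          (at (W y s \<bullet> W y s + \<delta>))"
        using has_real_derivative_powr[OF pos'] unfolding has_field_derivative_def .
      have 2: "((\<lambda>y. W y s \<bullet> W y s + \<delta>) has_derivative (\<lambda>h. 2 * (W y s \<bullet> W' y s h))) (at y)"
        by (auto intro!: derivative_eq_intros W' simp: inner_commute)
      show ?thesis
        unfolding gderiv_def inner_commute[of _ "sum _ _"] gf
        using has_derivative_compose[OF 2 1] by (simp add: \<beta>_def mult_ac)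
    qed
    have [continuous_intros]: "continuous_on A (\<lambda>x. \<beta> (g x) (h x))"
      if "continuous_on A g" "continuous_on A h" for A :: "('a \<times> real) set" and g h
      unfolding \<beta>_def using pos' by (intro continuous_intros that) (auto simp: less_imp_neq[symmetric])
    show "continuous_on UNIV (\<lambda>(y, s). (W y s \<bullet> W y s + \<delta>) powr (p/2))"
      using pos' by (auto simp: case_prod_unfold less_imp_neq[symmetric] intro!: continuous_intros)
    show "continuous_on UNIV (\<lambda>(y, s). \<beta> y s * (W y s \<bullet> Wt y s))"
      by (auto simp: case_prod_unfold intro!: continuous_intros)
    show "continuous_on UNIV (\<lambda>(y, s). \<Sum>i\<in>Basis. (\<beta> y s * (W y s \<bullet> W' y s i)) *\<^sub>R i)"
      by (auto simp: case_prod_unfold intro!: continuous_intros)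
    show "- (p * m) * (W y s \<bullet> W y s + \<delta>) powr (p / 2) * \<phi> y
         \<le> \<phi> y * (\<beta> y s * (W y s \<bullet> Wt y s) + (\<Sum>i\<in>Basis. (\<beta> y s * (W y s \<bullet> W' y s i)) *\<^sub>R i) \<bullet> b y s)"
      if s: "s \<in> {0..T}" for y s
    proof (cases "\<phi> y = 0")
      case False
      \<comment> \<open>The regularisation costs nothing: enlarging \<open>W \<bullet> W\<close> to
        \<open>W \<bullet> W + \<delta>\<close> goes in the favourable direction because
        \<open>p * m\<close> is nonnegative.\<close>
      have "W y s \<bullet> W y s * (W y s \<bullet> W y s + \<delta>) powr (p/2 - 1)
          \<le> (W y s \<bullet> W y s + \<delta>) * (W y s \<bullet> W y s + \<delta>) powr (p/2 - 1)"
        using that \<open>\<delta> > 0\<close> by (intro mult_right_mono) auto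
      also have "\<dots> = (W y s \<bullet> W y s + \<delta>) powr (p/2)"
        using pos'[of y s] by (simp add: powr_mult_base)
      finally have 1: "p * m * (W y s \<bullet> W y s * (W y s \<bullet> W y s + \<delta>) powr (p/2 - 1))
          \<le> p * m * (W y s \<bullet> W y s + \<delta>) powr (p/2)"
        using p m by (intro mult_left_mono) auto
      have "\<beta> y s * (- m * (W y s \<bullet> W y s)) \<le> \<beta> y s * (W y s \<bullet> (Wt y s + W' y s (b y s)))"
        using p by (intro mult_left_mono ineq[OF s False]) (auto simp: \<beta>_def)
      then have "- (p * m) * (W y s \<bullet> W y s + \<delta>) powr (p / 2)
         \<le> \<beta> y s * (W y s \<bullet> Wt y s) + (\<Sum>i\<in>Basis. (\<beta> y s * (W y s \<bullet> W' y s i)) *\<^sub>R i) \<bullet> b y s"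
        using 1 unfolding gf by (simp add: \<beta>_def inner_add_right algebra_simps)
      from mult_left_mono[OF this pos[of y]] show ?thesis by (simp add: mult_ac)
    qed auto
  qed (auto simp: per)
  \<comment> \<open>Here \<open>\<delta> = 0\<close> is included, where the base may be 0;
    continuity survives because the exponent \<open>p / 2\<close> is positive.\<close>
  have powr: "continuous_on ((cbox 0 1 \<times> cbox 0 T) \<times> cbox l u)
     (\<lambda>z. (W (snd z) (snd (fst z)) \<bullet> W (snd z) (snd (fst z)) + fst (fst z)) powr (p / 2))"
    by (rule continuous_on_powr') (use p in \<open>auto intro!: continuous_intros\<close>)
  have "continuous_on {0..1} K" unfolding K_def cbox_interval[symmetric]
    by (intro integral_continuous_on_param)
       (unfold case_prod_unfold, intro integral_continuous_on_param, unfold case_prod_unfold,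
        intro continuous_on_mult powr, (intro continuous_intros)+)
  then have "(\<lambda>n. K (inverse (real (Suc n)))) \<longlonglongrightarrow> K 0"
    by (rule continuous_on_tendsto_compose[OF _ LIMSEQ_inverse_real_of_nat])
       (auto simp: field_simps)
  then have "K 0 \<le> 0"
    by (rule LIMSEQ_le_const2) (auto intro!: K)
  then show ?thesis unfolding K_def by (simp add: norm_powr_eq_inner_powr)
qed

section \<open>The vorticity equation\<close>

lemma bounded_bilinear_matrix_vector_mult:
  "bounded_bilinear ((*v) :: real^'n^'m \<Rightarrow> real^'n \<Rightarrow> real^'m)"
proof -
  have "linear (\<lambda>A :: real^'n^'m. A *v x)" for x
    by (rule linearI) (auto simp: matrix_vector_mult_add_rdistrib scaleR_matrix_vector_assoc)
  then show ?thesis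
    by (simp add: bilinear_conv_bounded_bilinear[symmetric] bilinear_def matrix_vector_mul_linear)
qed

lemma bounded_linear_transpose: "bounded_linear (transpose :: real^'n^'m \<Rightarrow> real^'m^'n)"
  by (simp add: linear_conv_bounded_linear[symmetric] linear_iff transpose_def vec_eq_iff)

lemmas continuous_on_matrix_vector_mult [continuous_intros] =
  bounded_bilinear.continuous_on[OF bounded_bilinear_matrix_vector_mult]

lemmas continuous_on_transpose [continuous_intros] =
  bounded_linear.continuous_on[OF bounded_linear_transpose]

lemma continuous_on_matrix_mult [continuous_intros]:
  fixes A :: "'a::topological_space \<Rightarrow> real^'n^'m" and B :: "'a \<Rightarrow> real^'k^'n"
  assumes "continuous_on S A" "continuous_on S B"
  shows "continuous_on S (\<lambda>x. A x ** B x)"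
  unfolding matrix_matrix_mult_def by (intro continuous_intros assms)

lemma matrix_vector_mult_axis_inner: "(A *v axis j 1) \<bullet> axis i 1 = (A :: real^'n^'m) $ i $ j"
  by (simp add: inner_axis matrix_vector_mul_component inner_axis' inner_real_def)

lemma sum_Basis_matrix_eq_trace: "(\<Sum>i\<in>Basis. (A *v i) \<bullet> i) = trace (A :: real^'n^'n)"
proof -
  have "(Basis :: (real^'n) set) = range (\<lambda>i. axis i 1)" by (auto simp: Basis_vec_def)
  moreover have "inj (\<lambda>i::'n. axis i (1::real))" by (auto simp: inj_def axis_eq_axis)
  ultimately have "(\<Sum>i\<in>Basis. (A *v i) \<bullet> i) = (\<Sum>i\<in>UNIV. (A *v axis i 1) \<bullet> axis i 1)"
    using sum.reindex[of "\<lambda>i. axis i 1" UNIV "\<lambda>i. (A *v i) \<bullet> i"] by (simp add: o_def)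
  then show ?thesis by (simp only: matrix_vector_mult_axis_inner trace_def)
qed

lemma norm_transpose: "norm (transpose A) = norm (A :: real^'n^'m)"
proof -
  have "(norm (transpose A))\<^sup>2 = (norm A)\<^sup>2"
    unfolding power2_norm_eq_inner inner_vec_def transpose_def by simp (rule sum.swap)
  then show ?thesis by simp
qed

text \<open>Each entry of the product is a row of \<open>A\<close> times a column of
  \<open>B\<close>; Cauchy-Schwarz per entry, then summation of the squares.\<close>

lemma norm_matrix_mult_le: "norm (A ** B) \<le> norm (A :: real^'n^'m) * norm (B :: real^'k^'n)"
proof (rule power2_le_imp_le)
  have sq: "(norm M)\<^sup>2 = (\<Sum>i\<in>UNIV. (norm (M $ i))\<^sup>2)" for M :: "real^'x^'y"
    by (simp add: power2_norm_eq_inner inner_vec_def)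
  have "(norm (A ** B))\<^sup>2 = (\<Sum>i\<in>UNIV. \<Sum>j\<in>UNIV. (A $ i \<bullet> transpose B $ j)\<^sup>2)"
    unfolding power2_norm_eq_inner
    by (simp add: inner_vec_def matrix_matrix_mult_def transpose_def power2_eq_square)
  also have "\<dots> \<le> (\<Sum>i\<in>UNIV. \<Sum>j\<in>UNIV. (norm (A $ i))\<^sup>2 * (norm (transpose B $ j))\<^sup>2)"
    by (intro sum_mono) (simp add: power_mult_distrib[symmetric] Cauchy_Schwarz_ineq2 abs_le_square_iff[symmetric])
  also have "\<dots> = (norm A)\<^sup>2 * (norm (transpose B))\<^sup>2"
    unfolding sq by (simp add: sum_product)
  finally show "(norm (A ** B))\<^sup>2 \<le> (norm A * norm B)\<^sup>2"
    by (simp add: norm_transpose power_mult_distrib)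
qed simp

lemma has_derivative_along_line:
  assumes "\<And>y. (g has_derivative g' y) (at y)"
  shows "((\<lambda>t. g (x + t *\<^sub>R h)) has_vector_derivative g' (x + t *\<^sub>R h) h) (at t)"
proof -
  have "((\<lambda>t. g (x + t *\<^sub>R h)) has_derivative (\<lambda>s. g' (x + t *\<^sub>R h) (0 + s *\<^sub>R h))) (at t)"
    by (rule has_derivative_compose[OF _ assms]) (auto intro!: derivative_eq_intros)
  then show ?thesis
    by (simp add: has_vector_derivative_def linear_cmul[OF has_derivative_linear[OF assms]])
qed

section \<open>Regularity of the fields and removal of the pressure\<close>

locale self_similar_profile =
  fixes \<alpha> :: real and V :: "real^3 \<Rightarrow> real \<Rightarrow> real^3" and P :: "real^3 \<Rightarrow> real \<Rightarrow> real"
  assumes \<alpha>: "\<alpha> > -1" and smooth: "C2x_C1t V" and Euler: "self_similar_Euler \<alpha> V P"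
begin

definition drift :: "real^3 \<Rightarrow> real \<Rightarrow> real^3" where
  "drift y s = (1 / (\<alpha> + 1)) *\<^sub>R y + V y s"

definition D2 :: "real^3 \<Rightarrow> real \<Rightarrow> real^3 \<Rightarrow> real^3^3" where
  "D2 y s h = frechet_derivative (\<lambda>x. Dx V x s) (at y) h"

lemma continuous_V: "continuous_on UNIV (\<lambda>(y, s). V y s)"
  and continuous_Dx: "continuous_on UNIV (\<lambda>(y, s). Dx V y s)"
  and continuous_dt: "continuous_on UNIV (\<lambda>(y, s). dt V y s)"
  and continuous_D2: "continuous_on UNIV (\<lambda>(y, s). D2 y s h)"
  using smooth by (auto simp: C2x_C1t_def D2_def)

lemmas continuous_fields [continuous_intros] = continuous_on_curried[OF continuous_V]
  continuous_on_curried[OF continuous_Dx] continuous_on_curried[OF continuous_dt]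
  continuous_on_curried[OF continuous_D2]

lemma V_has_derivative: "((\<lambda>x. V x s) has_derivative (\<lambda>h. Dx V y s *v h)) (at y)"
  using smooth unfolding C2x_C1t_def Dx_def jacobian_works by blast

lemma Dx_has_derivative: "((\<lambda>x. Dx V x s) has_derivative D2 y s) (at y)"
  using smooth unfolding C2x_C1t_def D2_def[abs_def] frechet_derivative_works[symmetric] by blast

lemma V_has_vector_derivative_time: "(V y has_vector_derivative dt V y s) (at s)"
  using smooth unfolding C2x_C1t_def dt_def by (auto simp: vector_derivative_works)

lemma div_free: "trace (Dx V y s) = 0"
  using Euler unfolding self_similar_Euler_def divx_def by blast

lemma linear_D2: "linear (D2 y s)"
  by (rule has_derivative_linear[OF Dx_has_derivative])

text \<open>Both sides are the mixed second derivative of \<open>V\<close> in the directions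
  \<open>h\<close> and \<open>k\<close>. The symmetry lets the direction of differentiation be
  exchanged with the vector acted on, so that the derivative of \<open>Dx V y s *v drift y s\<close>
  becomes a matrix applied to the direction.\<close>

lemma D2_symmetric: "D2 y s h *v k = D2 y s k *v h"
proof -
  have 1: "((\<lambda>t. V (x + t *\<^sub>R w) s $ i) has_real_derivative (Dx V (x + t *\<^sub>R w) s *v w) $ i) (at t)"
    for x w t i
    using has_derivative_along_line[OF bounded_linear.has_derivative[OF bounded_linear_vec_nth V_has_derivative]]
    by (simp add: has_real_derivative_iff_has_vector_derivative)
  have 2: "((\<lambda>t. (Dx V (x + t *\<^sub>R w) s *v v) $ i) has_real_derivative (D2 (x + t *\<^sub>R w) s w *v v) $ i) (at t)"
    for x w v t i
    using has_derivative_along_line[OF bounded_linear.has_derivative[OF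
          bounded_linear_compose[OF bounded_linear_vec_nth
          bounded_bilinear.bounded_linear_left[OF bounded_bilinear_matrix_vector_mult]] Dx_has_derivative]]
    by (simp add: has_real_derivative_iff_has_vector_derivative)
  \<comment> \<open>The plane through \<open>y\<close> spanned by \<open>h\<close> and
    \<open>k\<close>; the regrouped form that follows exhibits it as a line in
    \<open>r\<close>.\<close>
  define x where "x t r = y + r *\<^sub>R k + t *\<^sub>R h" for t r
  have x: "x t r = (y + t *\<^sub>R h) + r *\<^sub>R k" for t r by (simp add: x_def algebra_simps)
  have c: "isCont (\<lambda>(t, r). (D2 (x t r) s u *v v) $ i) (0, 0)" for u v i
  proof -
    have "continuous_on UNIV (\<lambda>(t, r). (D2 (x t r) s u *v v) $ i)"
      unfolding x_def case_prod_unfold by (intro continuous_intros)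
    then show ?thesis by (simp add: continuous_on_eq_continuous_at)
  qed
  have "(D2 (x 0 0) s k *v h) $ i = (D2 (x 0 0) s h *v k) $ i" for i
  proof (rule mixed_second_derivatives_equal[where F="\<lambda>t r. V (x t r) s $ i"
        and ?F1.0="\<lambda>t r. (Dx V (x t r) s *v h) $ i" and ?F2.0="\<lambda>t r. (Dx V (x t r) s *v k) $ i"
        and ?F12.0="\<lambda>t r. (D2 (x t r) s k *v h) $ i" and ?F21.0="\<lambda>t r. (D2 (x t r) s h *v k) $ i"])
    fix t r
    show "((\<lambda>t. V (x t r) s $ i) has_real_derivative (Dx V (x t r) s *v h) $ i) (at t)"
      unfolding x_def by (rule 1)
    show "((\<lambda>r. V (x t r) s $ i) has_real_derivative (Dx V (x t r) s *v k) $ i) (at r)"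
      unfolding x by (rule 1)
    show "((\<lambda>r. (Dx V (x t r) s *v h) $ i) has_real_derivative (D2 (x t r) s k *v h) $ i) (at r)"
      unfolding x by (rule 2)
    show "((\<lambda>t. (Dx V (x t r) s *v k) $ i) has_real_derivative (D2 (x t r) s h *v k) $ i) (at t)"
      unfolding x_def by (rule 2)
  qed (rule c)+
  then show ?thesis by (simp add: vec_eq_iff x_def)
qed

lemma continuous_drift: "continuous_on UNIV (\<lambda>(y, s). drift y s)"
  unfolding drift_def case_prod_unfold by (intro continuous_intros)

lemmas [continuous_intros] = continuous_on_curried[OF continuous_drift]

text \<open>The direction moves with the point while continuity of \<open>D2\<close> is known for
  constant directions only; linearity reduces one to the other.\<close>

lemma continuous_D2_drift: "continuous_on UNIV (\<lambda>(y, s). D2 y s (drift y s))"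
proof -
  have *: "D2 y s (drift y s) = (\<Sum>i\<in>Basis. (drift y s \<bullet> i) *\<^sub>R D2 y s i)" for y s
  proof -
    have "D2 y s (drift y s) = D2 y s (\<Sum>i\<in>Basis. (drift y s \<bullet> i) *\<^sub>R i)"
      by (simp add: euclidean_representation)
    then show ?thesis by (simp add: linear_sum[OF linear_D2] linear_cmul[OF linear_D2])
  qed
  show ?thesis unfolding * case_prod_unfold by (intro continuous_intros)
qed

lemmas [continuous_intros] = continuous_on_curried[OF continuous_D2_drift]

definition accel :: "real^3 \<Rightarrow> real \<Rightarrow> real^3" where
  "accel y s = (\<alpha> / (\<alpha> + 1)) *\<^sub>R V y s + Dx V y s *v drift y s"

text \<open>The Jacobian of \<open>accel\<close>. Its first term has coefficient 1 because
  \<open>\<alpha> / (\<alpha> + 1)\<close> from the damping and \<open>1 / (\<alpha> + 1)\<close>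
  from differentiating the scaling field add up to 1; this is the 1 in the vorticity decay
  rate.\<close>

definition Daccel :: "real^3 \<Rightarrow> real \<Rightarrow> real^3^3" where
  "Daccel y s = Dx V y s + D2 y s (drift y s) + Dx V y s ** Dx V y s"

lemma continuous_accel: "continuous_on UNIV (\<lambda>(y, s). accel y s)"
  and continuous_Daccel: "continuous_on UNIV (\<lambda>(y, s). Daccel y s)"
  unfolding accel_def Daccel_def case_prod_unfold by (intro continuous_intros)+

lemmas [continuous_intros] = continuous_on_curried[OF continuous_accel] continuous_on_curried[OF continuous_Daccel]

lemma drift_has_derivative:
  "((\<lambda>x. drift x s) has_derivative (\<lambda>h. (1 / (\<alpha> + 1)) *\<^sub>R h + Dx V y s *v h)) (at y)"
  unfolding drift_def by (auto intro!: derivative_eq_intros V_has_derivative)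

lemma accel_has_derivative: "((\<lambda>x. accel x s) has_derivative (\<lambda>h. Daccel y s *v h)) (at y)"
proof -
  have "((\<lambda>x. accel x s) has_derivative (\<lambda>h. (\<alpha> / (\<alpha> + 1)) *\<^sub>R (Dx V y s *v h)
      + (Dx V y s *v ((1 / (\<alpha> + 1)) *\<^sub>R h + Dx V y s *v h) + D2 y s h *v drift y s))) (at y)"
    unfolding accel_def
    by (intro has_derivative_add has_derivative_scaleR_right V_has_derivative drift_has_derivative
        Dx_has_derivative bounded_bilinear.FDERIV[OF bounded_bilinear_matrix_vector_mult])
  moreover have "(\<alpha> / (\<alpha> + 1)) *\<^sub>R (Dx V y s *v h)
      + (Dx V y s *v ((1 / (\<alpha> + 1)) *\<^sub>R h + Dx V y s *v h) + D2 y s h *v drift y s)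
      = Daccel y s *v h" for h
  proof -
    have "(\<alpha> / (\<alpha> + 1)) *\<^sub>R (Dx V y s *v h) + (1 / (\<alpha> + 1)) *\<^sub>R (Dx V y s *v h) = Dx V y s *v h"
      using \<alpha> by (simp add: scaleR_add_left[symmetric] add_divide_distrib[symmetric])
    then show ?thesis
      unfolding Daccel_def D2_symmetric[of _ _ h]
      by (simp add: matrix_vector_mult_add_rdistrib matrix_vector_right_distrib
          matrix_vector_mul_assoc[symmetric] matrix_vector_mult_scaleR algebra_simps)
  qed
  ultimately show ?thesis by simp
qed

lemma pressure_gradient: "GDERIV (\<lambda>x. P x s) y :> - (dt V y s + accel y s)"
proof -
  obtain g where "GDERIV (\<lambda>x. P x s) y :> g" and
    g: "dt V y s + (\<alpha> / (\<alpha> + 1)) *\<^sub>R V y s + (1 / (\<alpha> + 1)) *\<^sub>R (Dx V y s *v y)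
          + Dx V y s *v V y s = - g"
    using Euler unfolding self_similar_Euler_def by blast
  moreover have "g = - (dt V y s + accel y s)"
    using g unfolding accel_def drift_def
    by (simp add: matrix_vector_right_distrib matrix_vector_mult_scaleR minus_equation_iff[of _ g] algebra_simps)
  ultimately show ?thesis by simp
qed

text \<open>An arbitrary function of time may be added to the pressure, so only differences in space
  can be regular in \<open>s\<close>. They are line integrals of the gradient, which the equation
  expresses through continuous fields.\<close>

lemma pressure_difference_continuous_time: "continuous_on UNIV (\<lambda>s. P x s - P y s)"
proof -
  have "P x s - P y s = integral {0..1} (\<lambda>\<tau>. (x - y) \<bullet> - (dt V (y + \<tau> *\<^sub>R (x - y)) s + accel (y + \<tau> *\<^sub>R (x - y)) s))" for s
  proof -
    have "((\<lambda>\<tau>. (x - y) \<bullet> - (dt V (y + \<tau> *\<^sub>R (x - y)) s + accel (y + \<tau> *\<^sub>R (x - y)) s)) has_integral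
        P (y + 1 *\<^sub>R (x - y)) s - P (y + 0 *\<^sub>R (x - y)) s) {0..1}"
      using has_derivative_along_line[OF pressure_gradient[unfolded gderiv_def]]
      by (intro fundamental_theorem_of_calculus) (auto intro: has_vector_derivative_at_within)
    then show ?thesis by (simp add: integral_unique)
  qed
  then show ?thesis
    unfolding cbox_interval[symmetric]
    by (simp only:) (intro integral_continuous_on_param, unfold case_prod_unfold, intro continuous_intros)
qed

text \<open>The pressure need not be differentiable in time and \<open>dt V\<close> need not be differentiable in
  space, so the curl of the momentum equation is taken after integrating it in time, where
  \<open>V y s2 - V y s1 + \<integral> accel y s ds\<close> is the gradient of a \<open>C\<^sup>2\<close> function.\<close>

lemma time_integrated_curl:
  assumes "s1 \<le> s2"
  shows "((Dx V y s2 - Dx V y s1) *v k) \<bullet> h + integral {s1..s2} (\<lambda>s. (Daccel y s *v k) \<bullet> h)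
       = ((Dx V y s2 - Dx V y s1) *v h) \<bullet> k + integral {s1..s2} (\<lambda>s. (Daccel y s *v h) \<bullet> k)"
proof -
  \<comment> \<open>Subtracting from the value at the fixed point \<open>y\<close> makes the
    integrand continuous in time, and with this sign the gradient of \<open>Q\<close> is the time
    integral of \<open>dt V + accel\<close>.\<close>
  define Q where "Q x = integral {s1..s2} (\<lambda>s. P y s - P x s)" for x
  define G where "G x w = (V x s2 - V x s1) \<bullet> w + integral {s1..s2} (\<lambda>s. accel x s \<bullet> w)" for x w
  define G' where "G' x v w = ((Dx V x s2 - Dx V x s1) *v v) \<bullet> w
      + integral {s1..s2} (\<lambda>s. (Daccel x s *v v) \<bullet> w)" for x v w
  \<comment> \<open>The time derivative is integrated out before any derivative in space is
    taken.\<close>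
  have G: "integral {s1..s2} (\<lambda>s. (dt V x s + accel x s) \<bullet> w) = G x w" for x w
  proof -
    have "((\<lambda>s. dt V x s \<bullet> w) has_integral (V x s2 \<bullet> w - V x s1 \<bullet> w)) {s1..s2}"
      by (rule fundamental_theorem_of_calculus[OF assms])
        (rule bounded_linear.has_vector_derivative[OF bounded_linear_inner_left
          has_vector_derivative_at_within[OF V_has_vector_derivative_time]])
    moreover have "((\<lambda>s. accel x s \<bullet> w) has_integral integral {s1..s2} (\<lambda>s. accel x s \<bullet> w)) {s1..s2}"
      by (intro integrable_integral integrable_continuous_real continuous_intros)
    ultimately have "((\<lambda>s. dt V x s \<bullet> w + accel x s \<bullet> w) has_integral G x w) {s1..s2}"
      unfolding G_def inner_diff_left by (rule has_integral_add)
    then show ?thesis unfolding inner_add_left by (rule integral_unique)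
  qed
  have 1: "((\<lambda>t. Q (x + t *\<^sub>R w)) has_real_derivative G (x + t *\<^sub>R w) w) (at t)" for x w t
    unfolding Q_def G[symmetric] cbox_interval[symmetric]
  proof (rule leibniz_rule_field_derivative[where U=UNIV])
    fix t s
    have "((\<lambda>t. P (x + t *\<^sub>R w) s) has_real_derivative (w \<bullet> - (dt V (x + t *\<^sub>R w) s + accel (x + t *\<^sub>R w) s))) (at t)"
      using has_derivative_along_line[OF pressure_gradient[unfolded gderiv_def]]
      by (simp add: has_real_derivative_iff_has_vector_derivative)
    from DERIV_diff[OF DERIV_const[of "P y s"] this]
    show "((\<lambda>t. P y s - P (x + t *\<^sub>R w) s) has_real_derivative
        (dt V (x + t *\<^sub>R w) s + accel (x + t *\<^sub>R w) s) \<bullet> w) (at t)"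
      by (simp only: inner_minus_right diff_minus_eq_add add_0_left inner_commute[of w])
  next
    fix t
    show "(\<lambda>s. P y s - P (x + t *\<^sub>R w) s) integrable_on cbox s1 s2"
      by (intro integrable_continuous continuous_on_subset[OF pressure_difference_continuous_time]) auto
  next
    show "continuous_on (UNIV \<times> cbox s1 s2) (\<lambda>(t, s). (dt V (x + t *\<^sub>R w) s + accel (x + t *\<^sub>R w) s) \<bullet> w)"
      unfolding case_prod_unfold by (intro continuous_intros)
  qed auto
  have 2: "((\<lambda>t. G (x + t *\<^sub>R v) w) has_real_derivative G' (x + t *\<^sub>R v) v w) (at t)" for x v w t
    unfolding G_def G'_def
  proof (rule DERIV_add)
    have "((\<lambda>t. (V (x + t *\<^sub>R v) s2 - V (x + t *\<^sub>R v) s1) \<bullet> w) has_vector_derivative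
        (Dx V (x + t *\<^sub>R v) s2 *v v - Dx V (x + t *\<^sub>R v) s1 *v v) \<bullet> w) (at t)"
      by (intro has_derivative_along_line has_derivative_inner_left has_derivative_diff V_has_derivative)
    then show "((\<lambda>t. (V (x + t *\<^sub>R v) s2 - V (x + t *\<^sub>R v) s1) \<bullet> w) has_real_derivative
        ((Dx V (x + t *\<^sub>R v) s2 - Dx V (x + t *\<^sub>R v) s1) *v v) \<bullet> w) (at t)"
      by (simp add: has_real_derivative_iff_has_vector_derivative matrix_vector_mult_diff_rdistrib)
    show "((\<lambda>t. integral {s1..s2} (\<lambda>s. accel (x + t *\<^sub>R v) s \<bullet> w)) has_real_derivative
        integral {s1..s2} (\<lambda>s. (Daccel (x + t *\<^sub>R v) s *v v) \<bullet> w)) (at t)"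
      unfolding cbox_interval[symmetric]
    proof (rule leibniz_rule_field_derivative[where U=UNIV])
      fix t s
      have "((\<lambda>t. accel (x + t *\<^sub>R v) s \<bullet> w) has_vector_derivative (Daccel (x + t *\<^sub>R v) s *v v) \<bullet> w) (at t)"
        by (intro has_derivative_along_line has_derivative_inner_left accel_has_derivative)
      then show "((\<lambda>t. accel (x + t *\<^sub>R v) s \<bullet> w) has_real_derivative (Daccel (x + t *\<^sub>R v) s *v v) \<bullet> w) (at t)"
        by (simp add: has_real_derivative_iff_has_vector_derivative)
    next
      fix t
      show "(\<lambda>s. accel (x + t *\<^sub>R v) s \<bullet> w) integrable_on cbox s1 s2"
        by (intro integrable_continuous continuous_intros)
    next
      show "continuous_on (UNIV \<times> cbox s1 s2) (\<lambda>(t, s). (Daccel (x + t *\<^sub>R v) s *v v) \<bullet> w)"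
        unfolding case_prod_unfold by (intro continuous_intros)
    qed auto
  qed
  define x where "x t r = y + r *\<^sub>R k + t *\<^sub>R h" for t r
  have x: "x t r = (y + t *\<^sub>R h) + r *\<^sub>R k" for t r by (simp add: x_def algebra_simps)
  have c: "isCont (\<lambda>(t, r). G' (x t r) u v) (0, 0)" for u v
  proof -
    have "continuous_on UNIV (\<lambda>(t, r). G' (x t r) u v)"
      unfolding x_def G'_def case_prod_unfold cbox_interval[symmetric]
      by (intro continuous_intros integral_continuous_on_param, unfold case_prod_unfold, intro continuous_intros)
    then show ?thesis by (simp add: continuous_on_eq_continuous_at)
  qed
  have "G' (x 0 0) k h = G' (x 0 0) h k"
  proof (rule mixed_second_derivatives_equal[where F="\<lambda>t r. Q (x t r)"
        and ?F1.0="\<lambda>t r. G (x t r) h" and ?F2.0="\<lambda>t r. G (x t r) k"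
        and ?F12.0="\<lambda>t r. G' (x t r) k h" and ?F21.0="\<lambda>t r. G' (x t r) h k"])
    fix t r
    show "((\<lambda>t. Q (x t r)) has_real_derivative G (x t r) h) (at t)"
      unfolding x_def by (rule 1)
    show "((\<lambda>r. Q (x t r)) has_real_derivative G (x t r) k) (at r)"
      unfolding x by (rule 1)
    show "((\<lambda>r. G (x t r) h) has_real_derivative G' (x t r) k h) (at r)"
      unfolding x by (rule 2)
    show "((\<lambda>t. G (x t r) k) has_real_derivative G' (x t r) h k) (at t)"
      unfolding x_def by (rule 2)
  qed (rule c)+
  then show ?thesis by (simp add: x_def G'_def)
qed

text \<open>The curl as an antisymmetric matrix: vortex stretching becomes matrix products, which
  the Frobenius norm controls.\<close>

definition vort :: "real^3 \<Rightarrow> real \<Rightarrow> real^3^3" where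
  "vort y s = Dx V y s - transpose (Dx V y s)"

text \<open>The integrated curl identity, read entry by entry along axis vectors, shows that
  increments of \<open>vort\<close> in time are integrals of a continuous matrix field; the
  fundamental theorem of calculus then gives a classical time derivative.\<close>

lemma vort_has_vector_derivative:
  "(vort y has_vector_derivative transpose (Daccel y s) - Daccel y s) (at s)"
proof -
  let ?R = "\<lambda>s. transpose (Daccel y s) - Daccel y s"
  have cont: "continuous_on A ?R" for A by (intro continuous_intros)
  have incr: "vort y s2 = vort y s1 + integral {s1..s2} ?R" if "s1 \<le> s2" for s1 s2
  proof -
    have int: "?R integrable_on {s1..s2}" by (intro integrable_continuous_real cont)
    have "vort y s2 $ i $ j = (vort y s1 + integral {s1..s2} ?R) $ i $ j" for i j
    proof -
      have I: "(\<lambda>s. Daccel y s $ i $ j) integrable_on {s1..s2}" for i j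
        by (intro integrable_continuous_real continuous_intros)
      have "integral {s1..s2} ?R $ i $ j = integral {s1..s2} (\<lambda>s. ?R s $ i $ j)"
        using integral_linear[OF int bounded_linear_compose[OF bounded_linear_vec_nth bounded_linear_vec_nth], of i j]
        unfolding o_def by simp
      also have "\<dots> = integral {s1..s2} (\<lambda>s. Daccel y s $ j $ i) - integral {s1..s2} (\<lambda>s. Daccel y s $ i $ j)"
        by (simp add: transpose_def integral_diff[OF I I])
      finally show ?thesis
        using time_integrated_curl[OF that, of y "axis j 1" "axis i 1"]
        unfolding matrix_vector_mult_axis_inner
        by (simp add: vort_def transpose_def)
    qed
    then show ?thesis by (simp add: vec_eq_iff)
  qed
  \<comment> \<open>Integration starts at \<open>s - 1\<close> so that \<open>s\<close> is interior
    to the interval and the derivative is two-sided.\<close>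
  have "((\<lambda>u. integral {s - 1..u} ?R) has_vector_derivative ?R s) (at s within {s - 1..s + 1})"
    by (rule integral_has_vector_derivative[OF cont]) auto
  then have "((\<lambda>u. vort y (s - 1) + integral {s - 1..u} ?R) has_vector_derivative ?R s) (at s within {s - 1..s + 1})"
    by (auto intro!: derivative_eq_intros)
  then have "(vort y has_vector_derivative ?R s) (at s within {s - 1..s + 1})"
    by (rule has_vector_derivative_transform[rotated 2]) (auto simp: incr)
  then show ?thesis by (simp add: at_within_Icc_at)
qed

lemma vort_has_derivative:
  "((\<lambda>x. vort x s) has_derivative (\<lambda>h. D2 y s h - transpose (D2 y s h))) (at y)"
  unfolding vort_def
  by (intro has_derivative_diff bounded_linear.has_derivative[OF bounded_linear_transpose] Dx_has_derivative)

text \<open>For \<open>a = Dx V\<close> and \<open>W = vort\<close> the identity \<open>a\<^sup>2 - (a\<^sup>2)\<^sup>T = a W + W a\<^sup>T\<close> turns the vorticity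
  equation into \<open>W\<^sub>s + (drift \<cdot> \<nabla>) W = - (W + a W + W a\<^sup>T)\<close>.\<close>

lemma vorticity_inequality:
  assumes "norm (Dx V y s) \<le> M"
  shows "- (1 + 2 * M) * (vort y s \<bullet> vort y s) \<le> vort y s \<bullet>
    (transpose (Daccel y s) - Daccel y s + (D2 y s (drift y s) - transpose (D2 y s (drift y s))))"
proof -
  define a where "a = Dx V y s"
  define W where "W = vort y s"
  have eq: "transpose (Daccel y s) - Daccel y s + (D2 y s (drift y s) - transpose (D2 y s (drift y s)))
      = - (W + a ** W + W ** transpose a)"
  proof -
    have add: "transpose (X + Y) = transpose X + transpose Y" for X Y :: "real^3^3"
      by (simp add: transpose_def vec_eq_iff)
    \<comment> \<open>The two occurrences of \<open>a ** transpose a\<close> cancel.\<close>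
    have "a ** W + W ** transpose a = a ** a - transpose (a ** a)"
      unfolding W_def vort_def a_def[symmetric] matrix_transpose_mul
      by (simp add: matrix_matrix_mult_def vec_eq_iff transpose_def sum_subtractf[symmetric] sum.distrib[symmetric] algebra_simps)
    then show ?thesis
      unfolding Daccel_def add W_def vort_def a_def by (simp add: algebra_simps)
  qed
  have "W \<bullet> (a ** W) \<le> norm W * (norm a * norm W)" "W \<bullet> (W ** transpose a) \<le> norm W * (norm W * norm a)"
    using norm_cauchy_schwarz[of W "a ** W"] norm_cauchy_schwarz[of W "W ** transpose a"]
      mult_left_mono[OF norm_matrix_mult_le[of a W], of "norm W"]
      mult_left_mono[OF norm_matrix_mult_le[of W "transpose a"], of "norm W"]
    by (auto simp: norm_transpose)
  then have "W \<bullet> (a ** W) + W \<bullet> (W ** transpose a) \<le> 2 * norm a * (W \<bullet> W)"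
    by (simp add: power2_norm_eq_inner[symmetric] power2_eq_square algebra_simps)
  also have "\<dots> \<le> 2 * M * (W \<bullet> W)"
    using assms by (intro mult_right_mono) (auto simp: a_def)
  finally show ?thesis
    unfolding eq W_def[symmetric] by (simp add: inner_add_right algebra_simps)
qed

text \<open>Only the scaling part contributes, \<open>1 / (\<alpha> + 1)\<close> for each of the
  three dimensions.\<close>

lemma drift_divergence:
  "(\<Sum>i\<in>Basis. ((1 / (\<alpha> + 1)) *\<^sub>R i + Dx V y s *v i) \<bullet> i) = 3 / (\<alpha> + 1)"
  by (simp add: inner_add_left sum.distrib sum_Basis_matrix_eq_trace div_free)

lemma weighted_vorticity_inequality:
  assumes T: "0 \<le> T" and p: "0 < p" and M: "0 \<le> M"
    and per: "\<And>y s. V y (s + T) = V y s"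
    and g\<phi>: "\<And>y. GDERIV \<phi> y :> g\<phi> y" and cg\<phi>: "continuous_on UNIV g\<phi>"
    and supp: "\<And>y. y \<notin> cbox l u \<Longrightarrow> \<phi> y = 0" and pos: "\<And>y. 0 \<le> \<phi> y"
    and grad: "\<And>y s. s \<in> {0..T} \<Longrightarrow> \<phi> y \<noteq> 0 \<Longrightarrow> norm (Dx V y s) \<le> M"
  shows "integral {0..T} (\<lambda>s. integral (cbox l u) (\<lambda>y. norm (vort y s) powr p *
      ((3 / (\<alpha> + 1) - p * (1 + 2 * M)) * \<phi> y + g\<phi> y \<bullet> drift y s))) \<le> 0"
proof (rule periodic_transport_powr[OF T p _ vort_has_vector_derivative vort_has_derivative
      drift_has_derivative g\<phi> _ _ _ _ _ cg\<phi> drift_divergence supp pos])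
  show "vort y T = vort y 0" for y
    using per[of _ 0] by (simp add: vort_def Dx_def)
qed (use M vorticity_inequality grad in \<open>auto simp: case_prod_unfold vort_def intro!: continuous_intros\<close>)

end

section \<open>Vanishing of the vorticity\<close>

text \<open>Each curl component occurs twice in the matrix, with opposite signs.\<close>

lemma norm_antisymmetric_part_eq_curl:
  "norm (Dx V y s - transpose (Dx V y s)) = sqrt 2 * norm (curlx V y s)"
proof -
  have "(norm (Dx V y s - transpose (Dx V y s)))\<^sup>2 = (sqrt 2 * norm (curlx V y s))\<^sup>2"
    unfolding power_mult_distrib power2_norm_eq_inner curlx_def
    by (simp add: inner_vec_def sum_3 transpose_def) (simp add: algebra_simps)
  then show ?thesis by simp
qed

context self_similar_profile
begin

lemma continuous_vort: "continuous_on UNIV (\<lambda>(y, s). vort y s)"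
  unfolding vort_def case_prod_unfold by (intro continuous_intros)

lemmas [continuous_intros] = continuous_on_curried[OF continuous_vort]

text \<open>Without vorticity the second derivatives are symmetric in all three indices, so the
  Laplacian of \<open>V \<bullet> w\<close> is the derivative of the divergence in the direction
  \<open>w\<close>, which is 0. The maximum principle then applies to every component.\<close>

lemma irrotational_decaying_imp_zero:
  assumes vort: "\<And>y. vort y s = 0" and decay: "((\<lambda>y. V y s) \<longlongrightarrow> 0) at_infinity"
  shows "V x s = 0"
proof -
  have symm: "(A *v h) \<bullet> k = (A *v k) \<bullet> h" if "transpose A = A" for A :: "real^3^3" and h k
    by (metis dot_lmul_matrix inner_commute that transpose_matrix_vector)
  have tr: "transpose (D2 y s h) = D2 y s h" for y h
  proof -
    have "((\<lambda>x. 0) has_derivative (\<lambda>h. D2 y s h - transpose (D2 y s h))) (at y)"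
      using vort_has_derivative[of s y] by (simp add: vort)
    from has_derivative_unique[OF this has_derivative_const] show ?thesis
      by (metis eq_iff_diff_eq_0)
  qed
  have trace: "trace (D2 y s h) = 0" for y h
  proof -
    have bl: "bounded_linear (trace :: real^3^3 \<Rightarrow> real)"
      by (simp add: linear_conv_bounded_linear[symmetric] linear_iff trace_def sum.distrib sum_distrib_left)
    have "((\<lambda>x. 0) has_derivative (\<lambda>h. trace (D2 y s h))) (at y)"
      using bounded_linear.has_derivative[OF bl Dx_has_derivative[of s y]] by (simp add: div_free)
    from has_derivative_unique[OF this has_derivative_const] show ?thesis by metis
  qed
  have "V x s \<bullet> w \<le> 0" for w
  proof (rule harmonic_vanishing_at_infinity_nonpos[where u="\<lambda>y. V y s \<bullet> w"
        and ?u1.0="\<lambda>i y. (Dx V y s *v i) \<bullet> w" and ?u2.0="\<lambda>i y. (D2 y s i *v i) \<bullet> w"])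
    show "continuous_on UNIV (\<lambda>y. V y s \<bullet> w)" by (intro continuous_intros)
    show "((\<lambda>t. V (y + t *\<^sub>R i) s \<bullet> w) has_real_derivative (Dx V (y + t *\<^sub>R i) s *v i) \<bullet> w) (at t)" for i y t
      using has_derivative_along_line[OF has_derivative_inner_left[OF V_has_derivative]]
      by (simp add: has_real_derivative_iff_has_vector_derivative)
    show "((\<lambda>t. (Dx V (y + t *\<^sub>R i) s *v i) \<bullet> w) has_real_derivative (D2 y s i *v i) \<bullet> w) (at 0)" for i y
      using has_derivative_along_line[OF has_derivative_inner_left[OF bounded_linear.has_derivative[OF
          bounded_bilinear.bounded_linear_left[OF bounded_bilinear_matrix_vector_mult] Dx_has_derivative]], where x=y and h=i and t=0]
      by (simp add: has_real_derivative_iff_has_vector_derivative)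
    show "(\<Sum>i\<in>Basis. (D2 y s i *v i) \<bullet> w) = 0" for y
    proof -
      have "(D2 y s i *v i) \<bullet> w = (D2 y s w *v i) \<bullet> i" for i
        using symm[OF tr, of y i i w] by (simp add: D2_symmetric[of y s i w])
      then show ?thesis by (simp add: sum_Basis_matrix_eq_trace trace)
    qed
    show "((\<lambda>y. V y s \<bullet> w) \<longlongrightarrow> 0) at_infinity"
      using tendsto_inner[OF decay tendsto_const[of w]] by simp
  qed
  \<comment> \<open>The one-sided bound suffices, since \<open>w\<close> may be \<open>V x s\<close>
    itself.\<close>
  from this[of "V x s"] show ?thesis using inner_ge_zero[of "V x s"] by (metis inner_eq_zero_iff order_antisym)
qed

text \<open>The weight is a profile \<open>\<eta>\<close> of \<open>y \<bullet> y\<close> times a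
  squared cutoff that ends where \<open>y \<bullet> y = L\<close>. Being radial, it meets the drift
  only through \<open>y \<bullet> drift y s\<close>, whose sign and size are known far out.\<close>

lemma radial_vorticity_inequality:
  assumes T: "0 \<le> T" and p: "0 < p" and M: "0 \<le> M" and L: "1 \<le> L"
    and per: "\<And>y s. V y (s + T) = V y s"
    and \<eta>: "\<And>t. (\<eta> has_real_derivative \<eta>' t) (at t)" and c\<eta>': "continuous_on UNIV \<eta>'"
    and \<eta>_pos: "\<And>t. 0 \<le> \<eta> t"
    and grad: "\<And>y s. s \<in> {0..T} \<Longrightarrow> \<eta> (y \<bullet> y) \<noteq> 0 \<Longrightarrow> norm (Dx V y s) \<le> M"
  shows "integral (cbox (- (L *\<^sub>R One), 0) (L *\<^sub>R One, T)) (\<lambda>(y, s). norm (vort y s) powr p *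
      ((3 / (\<alpha> + 1) - p * (1 + 2 * M)) * (\<eta> (y \<bullet> y) * (max 0 (1 - (y \<bullet> y) / L))\<^sup>2)
       + 2 * (\<eta>' (y \<bullet> y) * (max 0 (1 - (y \<bullet> y) / L))\<^sup>2 - \<eta> (y \<bullet> y) * (2 * max 0 (1 - (y \<bullet> y) / L) / L))
         * (y \<bullet> drift y s))) \<le> 0"
proof -
  have c\<eta>: "continuous_on UNIV \<eta>"
    using \<eta> by (intro continuous_at_imp_continuous_on ballI DERIV_isCont)
  note [continuous_intros] = continuous_on_compose2[OF c\<eta> _ subset_UNIV] continuous_on_compose2[OF c\<eta>' _ subset_UNIV]
  define \<psi> where "\<psi> t = \<eta> t * (max 0 (1 - t / L))\<^sup>2" for t
  define \<psi>' where "\<psi>' t = \<eta>' t * (max 0 (1 - t / L))\<^sup>2 - \<eta> t * (2 * max 0 (1 - t / L) / L)" for t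
  have \<psi>: "(\<psi> has_real_derivative \<psi>' t) (at t)" for t
  proof -
    have "((\<lambda>t. 1 - t / L) has_real_derivative - (1 / L)) (at t)"
      using L by (auto intro!: derivative_eq_intros)
    from DERIV_mult[OF \<eta> DERIV_chain2[OF max_0_square_has_derivative this]] show ?thesis
      unfolding \<psi>_def \<psi>'_def by (rule DERIV_cong) (simp add: algebra_simps)
  qed
  have c\<psi>': "continuous_on UNIV \<psi>'" unfolding \<psi>'_def using L by (intro continuous_intros) auto
  have c\<psi>: "continuous_on UNIV \<psi>" unfolding \<psi>_def using L by (intro continuous_intros) auto
  note [continuous_intros] = continuous_on_compose2[OF c\<psi> _ subset_UNIV] continuous_on_compose2[OF c\<psi>' _ subset_UNIV]
  have g: "GDERIV (\<lambda>y. \<psi> (y \<bullet> y)) y :> (2 * \<psi>' (y \<bullet> y)) *\<^sub>R y" for y :: "real^3"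
  proof -
    have "GDERIV (\<lambda>y. y \<bullet> y) y :> 2 *\<^sub>R y"
      unfolding gderiv_def by (auto intro!: derivative_eq_intros simp: inner_commute)
    from GDERIV_DERIV_compose[OF this \<psi>] show ?thesis by (simp add: mult.commute)
  qed
  let ?F = "\<lambda>y s. norm (vort y s) powr p * ((3 / (\<alpha> + 1) - p * (1 + 2 * M)) * \<psi> (y \<bullet> y)
      + ((2 * \<psi>' (y \<bullet> y)) *\<^sub>R y) \<bullet> drift y s)"
  have "integral {0..T} (\<lambda>s. integral (cbox (- (L *\<^sub>R One)) (L *\<^sub>R One)) (\<lambda>y. ?F y s)) \<le> 0"
  proof (rule weighted_vorticity_inequality[OF T p M per g])
    show "\<psi> (y \<bullet> y) = 0" if "y \<notin> cbox (- (L *\<^sub>R One)) (L *\<^sub>R One)" for y :: "real^3"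
    proof -
      have "\<exists>i\<in>Basis. L < \<bar>y \<bullet> i\<bar>"
      proof (rule ccontr)
        assume "\<not> (\<exists>i\<in>Basis. L < \<bar>y \<bullet> i\<bar>)"
        then have "\<bar>y \<bullet> i\<bar> \<le> L" if "i \<in> Basis" for i
          using that by (simp add: not_less)
        then have "y \<in> cbox (- (L *\<^sub>R One)) (L *\<^sub>R One)"
          by (simp add: mem_box abs_le_iff minus_le_iff)
        with that show False by simp
      qed
      then obtain i :: "real^3" where i: "i \<in> Basis" "\<bar>y \<bullet> i\<bar> > L" by blast
      have "L < norm y" using i Basis_le_norm[OF i(1), of y] by simp
      \<comment> \<open>The cutoff ends at radius \<open>sqrt L\<close>, and
        \<open>1 \<le> L\<close> places that ball inside the box of half-width
        \<open>L\<close>.\<close>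
      then have "L * L \<le> y \<bullet> y"
        using L by (auto simp: power2_norm_eq_inner[symmetric] power2_eq_square intro!: mult_mono)
      moreover have "L * 1 \<le> L * L" using L by (intro mult_left_mono) auto
      ultimately have "L \<le> y \<bullet> y" by linarith
      then have "1 - (y \<bullet> y) / L \<le> 0" using L by (simp add: field_simps)
      then show ?thesis by (simp add: \<psi>_def max_def)
    qed
    show "norm (Dx V y s) \<le> M" if "s \<in> {0..T}" "\<psi> (y \<bullet> y) \<noteq> 0" for y s
      using that grad by (auto simp: \<psi>_def)
  qed (auto simp: \<psi>_def \<eta>_pos intro!: continuous_intros)
  also have "integral {0..T} (\<lambda>s. integral (cbox (- (L *\<^sub>R One)) (L *\<^sub>R One)) (\<lambda>y. ?F y s))
    = integral (cbox (- (L *\<^sub>R One), 0) (L *\<^sub>R One, T)) (\<lambda>(y, s). ?F y s)"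
  proof -
    have c: "continuous_on (cbox (- (L *\<^sub>R One), 0) (L *\<^sub>R One, T)) (\<lambda>(y, s). ?F y s)"
    proof -
      have "continuous_on UNIV (\<lambda>z. norm (vort (fst z) (snd z)) powr p)"
        by (rule continuous_on_powr') (use p in \<open>auto intro!: continuous_intros\<close>)
      then have "continuous_on UNIV (\<lambda>(y, s). ?F y s)"
        unfolding case_prod_unfold by (intro continuous_on_mult) (auto intro!: continuous_intros)
      then show ?thesis by (rule continuous_on_subset) auto
    qed
    show ?thesis
      using integral_prod_continuous[OF c] integral_swap_continuous[OF c]
      by (simp add: cbox_interval)
  qed
  finally show ?thesis by (simp add: \<psi>_def \<psi>'_def mult.assoc)
qed

end

section \<open>Decay at infinity, bounded support, and vanishing of the vorticity\<close>

locale decaying_periodic_profile = self_similar_profile +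
  fixes S0 :: real
  assumes S0: "S0 > 0" and periodic: "\<And>y s. V y (s + S0) = V y s"
    and gradient_bounded: "bounded (range (\<lambda>(y, s). Dx V y s))"
    and decay: "((\<lambda>y. SUP s\<in>{0<..<S0}. norm (V y s) + norm (Dx V y s)) \<longlongrightarrow> 0) at_infinity"
begin

text \<open>The supremum is over the open period; compactness of the closed one makes it a genuine
  upper bound, and continuity carries the bound to both endpoints.\<close>

lemma uniform_decay:
  assumes "e > 0"
  obtains R where "\<And>y s. R \<le> norm y \<Longrightarrow> s \<in> {0..S0} \<Longrightarrow> norm (V y s) + norm (Dx V y s) \<le> e"
proof -
  let ?f = "\<lambda>y s. norm (V y s) + norm (Dx V y s)"
  obtain R where R: "\<And>y. R \<le> norm y \<Longrightarrow> \<bar>SUP s\<in>{0<..<S0}. ?f y s\<bar> < e"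
    using tendstoD[OF decay assms] by (auto simp: eventually_at_infinity dist_real_def)
  have "?f y s \<le> e" if y: "R \<le> norm y" and s: "s \<in> {0..S0}" for y s
  proof -
    have cont: "continuous_on A (?f y)" for A by (intro continuous_intros)
    have "compact (?f y ` {0..S0})" by (intro compact_continuous_image cont) simp
    then have bdd: "bdd_above (?f y ` {0<..<S0})"
      by (intro bdd_above_mono[OF bounded_imp_bdd_above[OF compact_imp_bounded]] image_mono) auto
    have le: "?f y t \<le> e" if "t \<in> {0<..<S0}" for t
      using cSUP_upper[OF that bdd] R[OF y] by linarith
    have "s \<in> closure {0<..<S0}" using s S0 by simp
    from continuous_le_on_closure[OF cont this le] show ?thesis .
  qed
  then show ?thesis using that by blast
qed

lemma continuous_vort_powr:
  assumes "0 < p"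
  shows "continuous_on UNIV (\<lambda>z. norm (vort (fst z) (snd z)) powr p)"
  by (rule continuous_on_powr') (use assms in \<open>auto intro!: continuous_intros\<close>)

text \<open>Far from the origin the drift points outward and expands volume at the rate \<open>3 / (\<alpha> + 1)\<close>, which beats
  the decay \<open>q (1 + 2 M)\<close> of \<open>|vort| powr q\<close> along trajectories.\<close>

lemma vort_compact_support:
  assumes q: "0 < q" "q < 3 / (\<alpha> + 1)"
    and int: "(\<lambda>(y, s). norm (vort y s) powr q) integrable_on (UNIV \<times> {0..S0})"
  obtains R where "\<And>y s. R < norm y \<Longrightarrow> s \<in> {0..S0} \<Longrightarrow> vort y s = 0"
proof -
  \<comment> \<open>Chosen so that \<open>2 * q * M\<close> uses up half of the gap
    \<open>3 / (\<alpha> + 1) - q\<close>; the other half is \<open>\<sigma>\<close>.\<close>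
  define M where "M = (3 / (\<alpha> + 1) - q) / (4 * q)"
  define \<sigma> where "\<sigma> = 3 / (\<alpha> + 1) - q * (1 + 2 * M)"
  define k where "k = 1 / (\<alpha> + 1)"
  have k: "k > 0" using \<alpha> by (simp add: k_def)
  have M: "M > 0" using q by (simp add: M_def)
  have "k - q * (1 + 2 * ((k - q) / (4 * q))) = (k - q) / 2" for k
    using q(1) by (simp add: field_simps)
  from this[of "3 / (\<alpha> + 1)"] have "\<sigma> = (3 / (\<alpha> + 1) - q) / 2" unfolding \<sigma>_def M_def .
  then have \<sigma>: "\<sigma> > 0" using q(2) by simp
  obtain R0 where R0: "\<And>y s. R0 \<le> norm y \<Longrightarrow> s \<in> {0..S0} \<Longrightarrow> norm (V y s) + norm (Dx V y s) \<le> min M k"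
    using uniform_decay[of "min M k"] M k by auto
  define R where "R = max 1 R0"
  have R1: "R \<ge> 1" by (simp add: R_def)
  have R: "norm (Dx V y s) \<le> M" "norm (V y s) \<le> k"
    if "R \<le> norm y" "s \<in> {0..S0}" for y s
    using R0[of y s] that norm_ge_zero[of "V y s"] norm_ge_zero[of "Dx V y s"]
    unfolding R_def by linarith+
  have out: "0 \<le> y \<bullet> drift y s" "y \<bullet> drift y s \<le> 2 * k * (y \<bullet> y)" if "R \<le> norm y" "s \<in> {0..S0}" for y s
  proof -
    have V: "norm (V y s) \<le> k * norm y"
      using R(2)[OF that] R1 that k mult_left_mono[of 1 "norm y" k] by linarith
    have "\<bar>y \<bullet> V y s\<bar> \<le> norm y * norm (V y s)" by (rule Cauchy_Schwarz_ineq2)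
    also have "norm y * norm (V y s) \<le> norm y * (k * norm y)"
      by (rule mult_left_mono[OF V]) simp
    also have "\<dots> = k * (y \<bullet> y)" by (simp add: power2_norm_eq_inner[symmetric] power2_eq_square)
    finally show "0 \<le> y \<bullet> drift y s" "y \<bullet> drift y s \<le> 2 * k * (y \<bullet> y)"
      by (auto simp: drift_def inner_add_right k_def[symmetric])
  qed
  \<comment> \<open>The inner cutoff \<open>\<eta>\<close> vanishes for
    \<open>norm y \<le> R\<close>, is positive beyond, increases, and stays at most 1.\<close>
  define u where "u t = max 0 (t - R\<^sup>2)" for t
  define \<eta> where "\<eta> t = (u t)\<^sup>2 / (1 + (u t)\<^sup>2)" for t
  define \<eta>' where "\<eta>' t = 2 * u t / (1 + (u t)\<^sup>2)\<^sup>2" for t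
  have u1: "1 + (u t)\<^sup>2 > 0" for t by (simp add: add_pos_nonneg)
  have \<eta>: "(\<eta> has_real_derivative \<eta>' t) (at t)" for t
  proof -
    have "((\<lambda>t. t - R\<^sup>2) has_real_derivative 1) (at t)" by (auto intro!: derivative_eq_intros)
    from DERIV_chain2[OF max_0_square_has_derivative this]
    have u2: "((\<lambda>t. (u t)\<^sup>2) has_real_derivative 2 * u t) (at t)" by (simp add: u_def)
    have "((\<lambda>v. v / (1 + v)) has_real_derivative 1 / (1 + (u t)\<^sup>2)\<^sup>2) (at ((u t)\<^sup>2))"
      using u1[of t] by (auto intro!: derivative_eq_intros simp: power2_eq_square[of "1 + _"])
    from DERIV_chain2[OF this u2] show ?thesis unfolding \<eta>_def \<eta>'_def by simp
  qed
  have cu: "continuous_on A u" for A unfolding u_def by (intro continuous_intros)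
  have c\<eta>': "continuous_on UNIV \<eta>'" unfolding \<eta>'_def
    using u1 by (intro continuous_intros cu) (auto simp: less_imp_neq[symmetric])
  have c\<eta>: "continuous_on UNIV \<eta>" unfolding \<eta>_def
    using u1 by (intro continuous_intros cu) (auto simp: less_imp_neq[symmetric])
  note [continuous_intros] = continuous_on_compose2[OF c\<eta> _ subset_UNIV]
  have \<eta>01: "0 \<le> \<eta> t" "\<eta> t \<le> 1" for t using u1[of t] by (auto simp: \<eta>_def field_simps)
  have \<eta>'0: "0 \<le> \<eta>' t" for t by (simp add: \<eta>'_def u_def)
  have far: "R \<le> norm y" if "\<eta> (y \<bullet> y) \<noteq> 0 \<or> \<eta>' (y \<bullet> y) \<noteq> 0" for y :: "real^3"
  proof -
    have "u (y \<bullet> y) \<noteq> 0" using that by (auto simp: \<eta>_def \<eta>'_def)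
    then have "R\<^sup>2 < (norm y)\<^sup>2" by (auto simp: u_def power2_norm_eq_inner max_def split: if_splits)
    then show ?thesis by (meson less_imp_le norm_ge_zero power2_le_imp_le)
  qed
  define w where "w = (\<lambda>z. norm (vort (fst z) (snd z)) powr q)"
  have cw: "continuous_on A w" for A
    using continuous_on_subset[OF continuous_vort_powr[OF q(1)]] by (simp add: w_def)
  have w0: "0 \<le> w z" for z by (simp add: w_def)
  define A where "A = (UNIV :: (real^3) set) \<times> {0..S0}"
  define m where "m n z = max 0 (1 - (fst z \<bullet> fst z) / real (Suc n))" for n and z :: "(real^3) \<times> real"
  \<comment> \<open>The integrand of the radial inequality for \<open>L = Suc n\<close> without the
    term in \<open>\<eta>'\<close>, which is nonnegative because the drift points outward where
    \<open>\<eta>'\<close> is nonzero.\<close>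
  define F where "F n z = w z * (\<eta> (fst z \<bullet> fst z) * (\<sigma> * (m n z)\<^sup>2
      - 4 * m n z / real (Suc n) * (fst z \<bullet> drift (fst z) (snd z))))" for n z
  define B where "B r = cbox (- (r *\<^sub>R One), 0) (r *\<^sub>R One :: real^3, S0)" for r
  have BA: "B r \<subseteq> A" for r by (auto simp: B_def A_def cbox_Pair_eq)
  have m01: "0 \<le> m n z" "m n z \<le> 1" for n z by (auto simp: m_def)
  have cF: "continuous_on C (F n)" for C n
    unfolding F_def m_def by (intro continuous_intros cw) auto
  have FB: "integral (B (real (Suc n))) (F n) \<le> 0" for n
  proof -
    let ?L = "real (Suc n)"
    let ?G = "\<lambda>(y, s). norm (vort y s) powr q *
      ((3 / (\<alpha> + 1) - q * (1 + 2 * M)) * (\<eta> (y \<bullet> y) * (max 0 (1 - (y \<bullet> y) / ?L))\<^sup>2)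
       + 2 * (\<eta>' (y \<bullet> y) * (max 0 (1 - (y \<bullet> y) / ?L))\<^sup>2 - \<eta> (y \<bullet> y) * (2 * max 0 (1 - (y \<bullet> y) / ?L) / ?L))
         * (y \<bullet> drift y s))"
    have "integral (B ?L) (F n) \<le> integral (B ?L) ?G"
    proof (rule integral_le)
      note [continuous_intros] = continuous_on_compose2[OF c\<eta>' _ subset_UNIV]
      show "F n integrable_on B ?L" unfolding B_def by (intro integrable_continuous cF)
      have "continuous_on (B ?L) ?G"
        unfolding case_prod_unfold using cw[unfolded w_def]
        by (intro continuous_on_mult) (auto intro!: continuous_intros)
      then show "?G integrable_on B ?L" unfolding B_def by (rule integrable_continuous)
      fix z assume "z \<in> B ?L"
      then obtain y s where z: "z = (y, s)" and s: "s \<in> {0..S0}" by (cases z) (auto simp: B_def cbox_Pair_eq)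
      have "0 \<le> \<eta>' (y \<bullet> y) * (m n z)\<^sup>2 * (y \<bullet> drift y s)"
        using \<eta>'0[of "y \<bullet> y"] far[of y] out(1)[OF _ s, of y]
        by (cases "\<eta>' (y \<bullet> y) = 0") (auto intro!: mult_nonneg_nonneg)
      from mult_left_mono[OF this w0[of z]]
      show "F n z \<le> ?G z"
        unfolding z F_def m_def w_def \<sigma>_def by (simp add: algebra_simps)
    qed
    also have "integral (B ?L) ?G \<le> 0"
      unfolding B_def
      using S0 M q(1) by (intro radial_vorticity_inequality periodic \<eta> c\<eta>' \<eta>01 R(1) far) auto
    finally show ?thesis .
  qed
  have F0: "F n z = 0" if "z \<in> A" "z \<notin> B (real (Suc n))" for n z
  proof -
    let ?L = "real (Suc n)"
    obtain y s where z: "z = (y, s)" and s: "s \<in> {0..S0}" using \<open>z \<in> A\<close> by (auto simp: A_def)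
    have "\<not> norm y \<le> ?L"
    proof
      assume "norm y \<le> ?L"
      then have "y \<in> cbox (- (?L *\<^sub>R One)) (?L *\<^sub>R One)"
        using Basis_le_norm[of _ y] by (fastforce simp: mem_box abs_le_iff)
      then show False using that s by (auto simp: B_def z cbox_Pair_eq)
    qed
    then have "?L * 1 \<le> norm y * norm y" by (intro mult_mono) auto
    then have "m n z = 0" by (auto simp: m_def z power2_norm_eq_inner[symmetric] power2_eq_square field_simps)
    then show ?thesis by (simp add: F_def)
  qed
  have FA: "(F n has_integral integral (B (real (Suc n))) (F n)) A" for n
  proof -
    have "(F n has_integral integral (B (real (Suc n))) (F n)) (B (real (Suc n)))"
      unfolding B_def by (intro integrable_integral integrable_continuous cF)
    then have "((\<lambda>z. if z \<in> B (real (Suc n)) then F n z else 0) has_integral integral (B (real (Suc n))) (F n)) A"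
      using has_integral_restrict[OF BA] by blast
    then show ?thesis by (rule has_integral_eq[rotated]) (use F0 in auto)
  qed
  define H where "H z = \<sigma> * (w z * \<eta> (fst z \<bullet> fst z))" for z
  have bound: "norm (F n z) \<le> (\<sigma> + 8 * k) * w z" if "z \<in> A" for n z
  proof (cases "\<eta> (fst z \<bullet> fst z) = 0")
    case True
    then show ?thesis using \<sigma> k w0[of z] by (simp add: F_def)
  next
    case False
    define d where "d = fst z \<bullet> drift (fst z) (snd z)"
    have d: "0 \<le> d" "d \<le> 2 * k * (fst z \<bullet> fst z)"
      using out[of "fst z" "snd z"] far[of "fst z"] False that by (auto simp: A_def d_def)
    have md: "0 \<le> m n z / real (Suc n) * d" using m01 d by simp
    \<comment> \<open>This balances the growth of the drift against the cutoff gradient: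
      \<open>y \<bullet> drift y s\<close> is at most a multiple of \<open>y \<bullet> y\<close>,
      and the cutoff vanishes once \<open>y \<bullet> y\<close> exceeds
      \<open>Suc n\<close>.\<close>
    have "m n z * ((fst z \<bullet> fst z) / real (Suc n)) \<le> 1"
    proof (cases "(fst z \<bullet> fst z) / real (Suc n) \<le> 1")
      case True
      then show ?thesis using m01[of n z] by (intro mult_le_one) auto
    qed (simp add: m_def)
    then have "2 * k * (m n z * ((fst z \<bullet> fst z) / real (Suc n))) \<le> 2 * k * 1"
      using k by (intro mult_left_mono) auto
    moreover have "m n z / real (Suc n) * d \<le> m n z / real (Suc n) * (2 * k * (fst z \<bullet> fst z))"
      using d m01 by (intro mult_left_mono) auto
    ultimately have md2: "m n z / real (Suc n) * d \<le> 2 * k"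
      by (simp add: algebra_simps)
    have sm: "0 \<le> \<sigma> * (m n z)\<^sup>2" "\<sigma> * (m n z)\<^sup>2 \<le> \<sigma> * 1"
      using \<sigma> m01[of n z] by (auto intro!: mult_left_mono simp: power_le_one)
    have "\<bar>\<sigma> * (m n z)\<^sup>2 - 4 * m n z / real (Suc n) * d\<bar> \<le> \<sigma> + 8 * k"
      using md md2 sm by (simp add: abs_le_iff)
    then have "\<eta> (fst z \<bullet> fst z) * \<bar>\<sigma> * (m n z)\<^sup>2 - 4 * m n z / real (Suc n) * d\<bar> \<le> 1 * (\<sigma> + 8 * k)"
      using \<eta>01 by (intro mult_mono) auto
    from mult_left_mono[OF this w0[of z]] show ?thesis
      using w0[of z] \<eta>01 by (simp add: F_def abs_mult d_def mult.commute)
  qed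
  have conv: "(\<lambda>n. F n z) \<longlonglongrightarrow> H z" for z
  proof -
    have i: "(\<lambda>n. 1 / real (Suc n)) \<longlonglongrightarrow> 0" using LIMSEQ_inverse_real_of_nat by (simp add: inverse_eq_divide)
    have "(\<lambda>n. max 0 (1 - (fst z \<bullet> fst z) * (1 / real (Suc n)))) \<longlonglongrightarrow> max 0 (1 - (fst z \<bullet> fst z) * 0)"
      by (intro tendsto_intros i)
    then have m: "(\<lambda>n. m n z) \<longlonglongrightarrow> 1" by (simp add: m_def)
    have "(\<lambda>n. w z * (\<eta> (fst z \<bullet> fst z) * (\<sigma> * (m n z)\<^sup>2
      - 4 * m n z * (1 / real (Suc n)) * (fst z \<bullet> drift (fst z) (snd z))))) \<longlonglongrightarrow>
        w z * (\<eta> (fst z \<bullet> fst z) * (\<sigma> * 1\<^sup>2 - 4 * 1 * 0 * (fst z \<bullet> drift (fst z) (snd z))))"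
      by (intro tendsto_intros m i)
    then show ?thesis by (simp add: F_def H_def mult_ac)
  qed
  have "w integrable_on A" using int by (simp add: w_def A_def case_prod_unfold)
  then have "(\<lambda>z. (\<sigma> + 8 * k) * w z) integrable_on A" by (rule integrable_on_mult_right)
  from dominated_convergence[OF has_integral_integrable[OF FA] this bound conv]
  have HA: "H integrable_on A" and lim: "(\<lambda>n. integral A (F n)) \<longlonglongrightarrow> integral A H" by auto
  \<comment> \<open>In the limit the outer cutoff and its gradient are gone. Since \<open>H\<close>
    is continuous and nonnegative, it must vanish on every box, and \<open>\<eta>\<close> is
    positive beyond \<open>R\<close>.\<close>
  have "integral A H \<le> 0"
    using lim FB by (intro LIMSEQ_le_const2[OF lim]) (auto simp: integral_unique[OF FA])
  have cH: "continuous_on C H" for C unfolding H_def by (intro continuous_intros cw)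
  have H0: "0 \<le> H z" for z using \<sigma> w0 \<eta>01 by (simp add: H_def)
  have "vort y s = 0" if y: "R < norm y" and s: "s \<in> {0..S0}" for y s
  proof -
    have yB: "(y, s) \<in> B (norm y)"
      using Basis_le_norm[of _ y] s by (fastforce simp: B_def cbox_Pair_eq mem_box abs_le_iff)
    have "integral (B (norm y)) H \<le> integral A H"
      using HA H0 cH BA unfolding B_def by (intro integral_subset_le integrable_continuous) auto
    then have "integral (B (norm y)) H \<le> 0" using \<open>integral A H \<le> 0\<close> by linarith
    moreover have "box (- (norm y *\<^sub>R One), 0) (norm y *\<^sub>R One :: real^3, S0) \<noteq> {}"
      using y R1 S0 by (auto simp: box_ne_empty Basis_prod_def)
    ultimately have "H (y, s) = 0"
      using yB H0 cH unfolding B_def by (intro zero_on_cbox_if_integral_nonpos) auto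
    moreover have "\<eta> (y \<bullet> y) > 0"
    proof -
      have "R\<^sup>2 < y \<bullet> y"
        using y R1 unfolding power2_norm_eq_inner[symmetric] by (intro power_strict_mono) auto
      then show ?thesis using u1[of "y \<bullet> y"] by (simp add: \<eta>_def u_def)
    qed
    ultimately show ?thesis using \<sigma> by (simp add: H_def w_def)
  qed
  then show ?thesis using that by blast
qed

text \<open>With compact support every small power of the vorticity is integrable, so that even the
  global gradient bound is beaten by the volume expansion.\<close>

lemma vort_zero_if_compact_support:
  assumes supp: "\<And>y s. R < norm y \<Longrightarrow> s \<in> {0..S0} \<Longrightarrow> vort y s = 0"
    and s: "s \<in> {0..S0}"
  shows "vort y s = 0"
proof -
  obtain M where M: "0 \<le> M" "\<And>y s. norm (Dx V y s) \<le> M"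
  proof -
    obtain b where "b > 0" "\<forall>x\<in>range (\<lambda>(y, s). Dx V y s). norm x \<le> b"
      using gradient_bounded unfolding bounded_pos by blast
    then show ?thesis by (intro that[of b]) auto
  qed
  \<comment> \<open>This exponent makes \<open>p * (1 + 2 * M)\<close> half of the expansion
    rate.\<close>
  define p where "p = 3 / (\<alpha> + 1) / (2 * (1 + 2 * M))"
  define \<sigma> where "\<sigma> = 3 / (\<alpha> + 1) / 2"
  have p: "0 < p" and \<sigma>: "0 < \<sigma>" using M \<alpha> by (auto simp: p_def \<sigma>_def add_pos_nonneg)
  have "x / (2 * n) * n = x / 2" if "n > 0" for x n :: real using that by simp
  from this[of "1 + 2 * M" "3 / (\<alpha> + 1)"] have \<sigma>p: "3 / (\<alpha> + 1) - p * (1 + 2 * M) = \<sigma>"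
    using M(1) unfolding p_def \<sigma>_def by linarith
  have "compact ((\<lambda>z. fst z \<bullet> drift (fst z) (snd z)) ` (cball 0 R \<times> {0..S0}))"
    by (intro compact_continuous_image compact_Times continuous_intros) auto
  from compact_imp_bounded[OF this] obtain K where K: "0 < K"
    and K1: "\<forall>x\<in>(\<lambda>z. fst z \<bullet> drift (fst z) (snd z)) ` (cball 0 R \<times> {0..S0}). norm x \<le> K"
    unfolding bounded_pos by (elim exE conjE)
  have K2: "\<bar>y \<bullet> drift y s\<bar> \<le> K" if "norm y \<le> R" "s \<in> {0..S0}" for y s
    using K1[THEN bspec, OF imageI, of "(y, s)"] that by simp
  \<comment> \<open>The summand \<open>norm y\<close> puts the given point into the box,
    \<open>2 * R\<^sup>2\<close> keeps the cutoff at least 1/2 on the support, and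
    \<open>16 * K / \<sigma>\<close> bounds the flux of its gradient by
    \<open>\<sigma> / 4\<close>.\<close>
  define L where "L = 1 + \<bar>R\<bar> + norm y + 2 * R\<^sup>2 + 16 * K / \<sigma>"
  have L: "1 \<le> L" "\<bar>R\<bar> \<le> L" "norm y \<le> L" "2 * R\<^sup>2 \<le> L" "16 * K / \<sigma> \<le> L"
    using K \<sigma> by (auto simp: L_def)
  define w where "w = (\<lambda>z. norm (vort (fst z) (snd z)) powr p)"
  have cw: "continuous_on A w" for A
    using continuous_on_subset[OF continuous_vort_powr[OF p]] by (simp add: w_def)
  define B where "B = cbox (- (L *\<^sub>R One), 0) (L *\<^sub>R One :: real^3, S0)"
  let ?G = "\<lambda>(y, s). norm (vort y s) powr p *
      ((3 / (\<alpha> + 1) - p * (1 + 2 * M)) * (1 * (max 0 (1 - (y \<bullet> y) / L))\<^sup>2)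
       + 2 * (0 * (max 0 (1 - (y \<bullet> y) / L))\<^sup>2 - 1 * (2 * max 0 (1 - (y \<bullet> y) / L) / L))
         * (y \<bullet> drift y s))"
  have cG: "continuous_on B ?G"
    unfolding case_prod_unfold using cw[unfolded w_def] L
    by (intro continuous_on_mult) (auto intro!: continuous_intros)
  \<comment> \<open>The constant is 1/2 from the cutoff times \<open>\<sigma> / 4\<close>, what the
    flux leaves of \<open>\<sigma> / 2\<close>. Where the vorticity vanishes both integrands are
    0.\<close>
  have "integral B (\<lambda>z. \<sigma> / 8 * w z) \<le> integral B ?G"
  proof (rule integral_le)
    show "(\<lambda>z. \<sigma> / 8 * w z) integrable_on B" "?G integrable_on B"
      using cG unfolding B_def by (auto intro!: integrable_continuous continuous_intros cw)
    fix z assume "z \<in> B"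
    then obtain y s where z: "z = (y, s)" and s: "s \<in> {0..S0}" by (cases z) (auto simp: B_def cbox_Pair_eq)
    show "\<sigma> / 8 * w z \<le> ?G z"
    proof (cases "vort y s = 0")
      case True
      then show ?thesis by (simp add: z w_def)
    next
      case False
      then have y: "norm y \<le> R" using supp[OF _ s, of y] by force
      define t where "t = 1 - (y \<bullet> y) / L"
      have "y \<bullet> y \<le> R\<^sup>2"
        using y unfolding power2_norm_eq_inner[symmetric] by (intro power_mono) auto
      then have t: "1 / 2 \<le> t" using L by (simp add: t_def field_simps)
      have "4 * ((y \<bullet> drift y s) / L) \<le> 4 * (K / L)"
        using K2[OF y s] L by (intro mult_left_mono divide_right_mono) auto
      also have "\<dots> \<le> \<sigma> / 4" using L \<sigma> by (simp add: field_simps)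
      finally have 1: "4 * ((y \<bullet> drift y s) / L) \<le> \<sigma> / 4" .
      have "\<sigma> * (1 / 2) \<le> \<sigma> * t" using t \<sigma> by (intro mult_left_mono) auto
      then have "\<sigma> / 4 \<le> \<sigma> * t - 4 * ((y \<bullet> drift y s) / L)" using 1 by linarith
      then have "1 / 2 * (\<sigma> / 4) \<le> t * (\<sigma> * t - 4 * ((y \<bullet> drift y s) / L))"
        using t \<sigma> by (intro mult_mono) auto
      from mult_left_mono[OF this, of "w z"]
      moreover have "max 0 (1 - (y \<bullet> y) / L) = t" using t by (simp add: t_def)
      ultimately show ?thesis unfolding \<sigma>p
        by (simp add: z w_def power2_eq_square algebra_simps)
    qed
  qed
  also have "integral B ?G \<le> 0"
    unfolding B_def using S0 p M L
    by (intro radial_vorticity_inequality[where \<eta>="\<lambda>_. 1" and \<eta>'="\<lambda>_. 0"] periodic) auto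
  finally have nonpos: "integral B (\<lambda>z. \<sigma> / 8 * w z) \<le> 0" .
  have ne: "box (- (L *\<^sub>R One), 0) (L *\<^sub>R One :: real^3, S0) \<noteq> {}"
    using L S0 by (auto simp: box_ne_empty Basis_prod_def)
  have mem: "(y, s) \<in> B"
    using Basis_le_norm[of _ y] s L(3) by (fastforce simp: B_def cbox_Pair_eq mem_box abs_le_iff)
  have "\<sigma> / 8 * w (y, s) = 0"
    using nonpos ne mem unfolding B_def
  proof (rule zero_on_cbox_if_integral_nonpos[rotated 2])
    show "continuous_on (cbox (- (L *\<^sub>R One), 0) (L *\<^sub>R One, S0)) (\<lambda>z. \<sigma> / 8 * w z)"
      by (intro continuous_intros cw)
  qed (use \<sigma> in \<open>simp add: w_def\<close>)
  then show ?thesis using \<sigma> by (simp add: w_def)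
qed

lemma V_zero_on_period:
  assumes q: "0 < q" "q < 3 / (\<alpha> + 1)"
    and int: "(\<lambda>(y, s). norm (vort y s) powr q) integrable_on (UNIV \<times> {0..S0})"
    and s: "s \<in> {0..S0}"
  shows "V y s = 0"
proof (rule irrotational_decaying_imp_zero)
  obtain R where "\<And>y s. R < norm y \<Longrightarrow> s \<in> {0..S0} \<Longrightarrow> vort y s = 0"
    using vort_compact_support[OF q int] by blast
  then show "vort x s = 0" for x using vort_zero_if_compact_support s by blast
  show "((\<lambda>y. V y s) \<longlongrightarrow> 0) at_infinity"
  proof (rule tendstoI)
    fix e :: real assume "e > 0"
    then obtain R where R: "\<And>y s. R \<le> norm y \<Longrightarrow> s \<in> {0..S0} \<Longrightarrow> norm (V y s) + norm (Dx V y s) \<le> e / 2"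
      using uniform_decay[of "e / 2"] by auto
    have "norm (V x s) < e" if "R \<le> norm x" for x
      using R[OF that s] \<open>e > 0\<close> norm_ge_zero[of "Dx V x s"] by linarith
    then show "\<forall>\<^sub>F y in at_infinity. dist (V y s) 0 < e"
      by (auto simp: eventually_at_infinity)
  qed
qed

end

section \<open>From the curl hypothesis on one period to all times\<close>

theorem theorem2p2:
  fixes \<alpha> S0 :: real
    and V :: "real^3 \<Rightarrow> real \<Rightarrow> real^3"
    and P :: "real^3 \<Rightarrow> real \<Rightarrow> real"
  assumes "\<alpha> > -1" and "S0 > 0"
    and "C2x_C1t V"
    and "\<forall>y s. V y (s + S0) = V y s"
    and "self_similar_Euler \<alpha> V P"
    and "bounded (range (\<lambda>(y, s). Dx V y s))" and "bounded (range (\<lambda>(y, s). dt V y s))"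
    and "((\<lambda>y. SUP s\<in>{0<..<S0}. norm (V y s) + norm (Dx V y s)) \<longlongrightarrow> 0) at_infinity"
    and "\<exists>q\<in>{0<..<3 / (1 + \<alpha>)}. in_Lq q (UNIV \<times> {0..S0}) (\<lambda>(y, s). curlx V y s)"
  shows "\<forall>y s. V y s = 0"
proof -
  interpret decaying_periodic_profile \<alpha> V P S0
    using assms by unfold_locales auto
  obtain q where q: "0 < q" "q < 3 / (\<alpha> + 1)" and Lq: "in_Lq q (UNIV \<times> {0..S0}) (\<lambda>(y, s). curlx V y s)"
    using assms(9) by (auto simp: add.commute)
  let ?A = "(UNIV :: (real^3) set) \<times> {0..S0}"
  have "(\<lambda>z. norm (case z of (y, s) \<Rightarrow> curlx V y s) powr q) integrable_on ?A"
  proof (rule integrable_on_lebesgue_on)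
    show "integrable (lebesgue_on ?A) (\<lambda>z. norm (case z of (y, s) \<Rightarrow> curlx V y s) powr q)"
      using Lq unfolding in_Lq_def by (intro integrableI_bounded) auto
    have "closed ?A" by (intro closed_Times) auto
    then show "?A \<in> sets lebesgue" by (intro sets_completionI_sets) auto
  qed
  \<comment> \<open>The factor accounts for the Frobenius norm of \<open>vort\<close> being
    \<open>sqrt 2\<close> times the norm of the curl.\<close>
  then have "(\<lambda>z. sqrt 2 powr q * norm (case z of (y, s) \<Rightarrow> curlx V y s) powr q) integrable_on ?A"
    by (rule integrable_on_mult_right)
  then have "(\<lambda>(y, s). norm (vort y s) powr q) integrable_on ?A"
    by (rule integrable_eq)
      (auto simp: vort_def norm_antisymmetric_part_eq_curl powr_mult)
  note zero = V_zero_on_period[OF q this]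
  show ?thesis
  proof (intro allI)
    fix y s
    interpret periodic_fun_simple "V y" S0
      by unfold_locales (rule periodic)
    \<comment> \<open>The number of whole periods by which \<open>s\<close> is shifted back into the
      base period.\<close>
    define n where "n = \<lfloor>s / S0\<rfloor>"
    have "s - of_int n * S0 \<in> {0..S0}"
      using floor_divide_lower[OF S0, of s] floor_divide_upper[OF S0, of s]
      by (auto simp: n_def algebra_simps)
    from zero[OF this, of y] show "V y s = 0"
      using minus_of_int[of s n] by simp
  qed
qed

end
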